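(* Let $(X,\|\cdot\|_X)$ be a $K$-convex complex Banach space. For every $p\in(1,\infty)$ there exist $\alpha(p,X)\in[1,2)$ and $C(p,X)\in(0,\infty)$ such that for every $n,d\in\mathbb{N}$ with $d\in\{1,\ldots,n\}$ and every function $f:\{-1,1\}^n\to X$ of degree at most $d$, we have $$\Big(\frac1{2^n}\sum_{\delta\in\{-1,1\}^n}\Big\|\sum_{i=1}^n\delta_i\partial_if\Big\|_{L_p(\{-1,1\}^n;X)}^p\Big)^{1/p}\leq C(p,X)\,d^{\alpha(p,X)}(\log d+1)\,\|f\|_{L_p(\{-1,1\}^n;X)}.$$
   Context: $\mathbb{N}=\{1,2,\ldots\}$; $\log$ is the natural logarithm. For $p\in[1,\infty)$, $\|f\|_{L_p(\{-1,1\}^n;X)}=\big(2^{-n}\sum_{\varepsilon\in\{-1,1\}^n}\|f(\varepsilon)\|_X^p\big)^{1/p}$. For $A\subseteq\{1,\ldots,n\}$, the Walsh function is $w_A(\varepsilon)=\prod_{i\in A}\varepsilon_i$. Every $f:\{-1,1\}^n\to X$ has the expansion $f=\sum_{A}\widehat f(A)w_A$ with $\widehat f(A)=2^{-n}\sum_{\delta}f(\delta)w_A(\delta)\in X$. The partial derivatives are $\partial_if(\varepsilon)=\frac{f(\varepsilon)-f(\varepsilon_1,\ldots,\varepsilon_{i-1},-\varepsilon_i,\varepsilon_{i+1},\ldots,\varepsilon_n)}2=\sum_{A\ni i}\widehat f(A)w_A(\varepsilon)$; for fixed $\delta$, $\sum_i\delta_i\partial_if$ is regarded as a function of $\varepsilon$.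 A function $f$ has degree at most $d$ if $\widehat f(A)=0$ whenever $|A|>d$. The Rademacher projection is $\mathsf{Rad}(f)(\varepsilon)=\sum_{i=1}^n\widehat f(\{i\})\varepsilon_i$. $X$ is $K$-convex if $\sup_{n\in\mathbb{N}}\|\mathsf{Rad}\|_{L_p(\{-1,1\}^n;X)\to L_p(\{-1,1\}^n;X)}<\infty$ for some (equivalently, for all) $p\in(1,\infty)$. *)

theory Defs
  imports "HOL-Analysis.Analysis"
begin

section \<open>Complex Banach spaces\<close>

class complex_normed_vector = real_normed_vector +
  fixes scaleC :: "complex \<Rightarrow> 'a \<Rightarrow> 'a"  (infixr \<open>*\<^sub>C\<close> 75)
  assumes scaleC_add_right: "a *\<^sub>C (x + y) = a *\<^sub>C x + a *\<^sub>C y"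
    and scaleC_add_left: "(a + b) *\<^sub>C x = a *\<^sub>C x + b *\<^sub>C x"
    and scaleC_scaleC: "a *\<^sub>C (b *\<^sub>C x) = (a * b) *\<^sub>C x"
    and scaleC_one: "1 *\<^sub>C x = x"
    and scaleR_scaleC: "scaleR r x = complex_of_real r *\<^sub>C x"
    and norm_scaleC: "norm (a *\<^sub>C x) = cmod a * norm x"

class complex_banach = complex_normed_vector + banach

instantiation complex :: complex_banach
begin

definition scaleC_complex :: "complex \<Rightarrow> complex \<Rightarrow> complex"
  where "scaleC_complex a x = a * x"

instance
  by standard (simp_all add: scaleC_complex_def algebra_simps scaleR_conv_of_real norm_mult)

end


section \<open>Analysis on the discrete hypercube\<close>

text \<open>The dimension \<open>n\<close> varies, so a point of the cube is a function on \<open>nat\<close> which is extensional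
  outside \<open>{1..n}\<close>. A function on the cube is a total HOL function; every notion below depends only
  on its values on \<open>hcube n\<close>.\<close>

definition hcube :: "nat \<Rightarrow> (nat \<Rightarrow> real) set"
  where "hcube n = {1..n} \<rightarrow>\<^sub>E {-1, 1}"

definition Lp_norm :: "nat \<Rightarrow> real \<Rightarrow> ((nat \<Rightarrow> real) \<Rightarrow> 'a::real_normed_vector) \<Rightarrow> real"
  where "Lp_norm n p f = (1 / 2 ^ n * (\<Sum>\<epsilon>\<in>hcube n. norm (f \<epsilon>) powr p)) powr (1 / p)"

definition walsh :: "nat set \<Rightarrow> (nat \<Rightarrow> real) \<Rightarrow> real"
  where "walsh A \<epsilon> = (\<Prod>i\<in>A. \<epsilon> i)"

definition fourier_coeff :: "nat \<Rightarrow> ((nat \<Rightarrow> real) \<Rightarrow> 'a::real_normed_vector) \<Rightarrow> nat set \<Rightarrow> 'a"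
  where "fourier_coeff n f A = (1 / 2 ^ n) *\<^sub>R (\<Sum>\<delta>\<in>hcube n. walsh A \<delta> *\<^sub>R f \<delta>)"

definition degree_at_most :: "nat \<Rightarrow> nat \<Rightarrow> ((nat \<Rightarrow> real) \<Rightarrow> 'a::real_normed_vector) \<Rightarrow> bool"
  where "degree_at_most n d f \<longleftrightarrow> (\<forall>A\<subseteq>{1..n}. card A > d \<longrightarrow> fourier_coeff n f A = 0)"

definition partial_deriv ::
    "nat \<Rightarrow> ((nat \<Rightarrow> real) \<Rightarrow> 'a::real_normed_vector) \<Rightarrow> (nat \<Rightarrow> real) \<Rightarrow> 'a"
  where "partial_deriv i f \<epsilon> = (1 / 2) *\<^sub>R (f \<epsilon> - f (\<epsilon>(i := - \<epsilon> i)))"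

definition Rad :: "nat \<Rightarrow> ((nat \<Rightarrow> real) \<Rightarrow> 'a::real_normed_vector) \<Rightarrow> (nat \<Rightarrow> real) \<Rightarrow> 'a"
  where "Rad n f \<epsilon> = (\<Sum>i=1..n. \<epsilon> i *\<^sub>R fourier_coeff n f {i})"


section \<open>K-convexity\<close>

text \<open>The operator norm of the Rademacher projection on \<open>L\<^sub>p({-1,1}\<^sup>n; X)\<close>, for \<open>X\<close> the type
  \<open>'a\<close>. Suprema are taken in \<open>ennreal\<close>, so that they exist and boundedness is finiteness.\<close>

definition Rad_opnorm :: "'a::real_normed_vector itself \<Rightarrow> nat \<Rightarrow> real \<Rightarrow> ennreal"
  where "Rad_opnorm _ n p =
    (SUP f \<in> {f :: (nat \<Rightarrow> real) \<Rightarrow> 'a. Lp_norm n p f \<le> 1}. ennreal (Lp_norm n p (Rad n f)))"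

definition K_convex :: "'a::real_normed_vector itself \<Rightarrow> bool"
  where "K_convex T \<longleftrightarrow> (\<exists>p>1. (SUP n\<in>{1..}. Rad_opnorm T n p) < \<infinity>)"

end

theory Submission
  imports Defs "HOL-Complex_Analysis.Cauchy_Integral_Formula"
begin

text \<open>
  All operators involved are Fourier multipliers of the cube, and the vector space \<open>X\<close> enters only
  through one number: a bound \<open>K\<close>, uniform in the dimension, for the Rademacher projection.

  Averaging over random sets of coordinates turns this number into the analyticity of the heat
  semigroup. Applying the projection in a random block and a higher projection in the complementary
  coordinates shows by induction that the projection onto degree \<open>k\<close> has norm at most
  \<open>(exp 1 * K) ^ k\<close> (\<open>multiplier_bound_level\<close>), so that \<open>w\<^sub>A \<mapsto> \<sigma> ^ card A * w\<^sub>A\<close> has norm at most \<open>2\<close>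
  for complex \<open>\<sigma>\<close> near \<open>0\<close>. Applying this operator in a random block of density \<open>q\<close>
  replaces \<open>\<sigma>\<close> by \<open>1 - q * (1 - \<sigma>)\<close>; the bound thus holds on the convex hull of a disc about \<open>0\<close> and the point
  \<open>1\<close> (\<open>multiplier_bound_cone\<close>), a region with a positive angle at \<open>1\<close>.

  For \<open>f\<close> of degree at most \<open>d\<close> the function \<open>\<rho> \<mapsto> \<Sum>\<^sub>A \<rho> ^ card A * fourier_coeff n f A * w\<^sub>A\<close> is a vector-valued polynomial
  of degree \<open>d\<close>, bounded on that region. Because of the angle, the maximum principle lets it be continued
  past \<open>1\<close> to \<open>1 + s\<close> with \<open>s\<close> of order \<open>1 / d powr \<alpha>\<close> and \<open>\<alpha> < 2\<close>, without
  losing more than a constant (\<open>corner_extrapolation\<close>); a segment instead of an angle would only give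
  \<open>\<alpha> = 2\<close>.

  Finally the random gradient of \<open>f\<close> is \<open>1 / s\<close> times an average of Rademacher projections, in random blocks of
  coordinates, of the function \<open>g\<close> so obtained at \<open>\<rho> = 1 + s\<close> (\<open>random_gradient_as_average\<close>). Its norm
  is therefore at most \<open>K / s\<close> times the norm of \<open>g\<close>, and hence of order \<open>d powr \<alpha>\<close>
  times the norm of \<open>f\<close>.

  K-convexity is given for a single exponent. The passage to every \<open>p > 1\<close> uses hypercontractivity
  (\<open>multiplier_hypercontractive\<close>): the noise operator acts on the range of the Rademacher projection as a
  positive scalar, and it maps the smaller of the two exponents to the larger.
\<close>

section \<open>Averaged norms over finite index sets\<close>

text \<open>The index set is arbitrary so that the same norm serves for the cube, for products of two cubes
  (where it gives Fubini and the mixed-norm inequalities) and for a single coordinate \<open>{-1, 1}\<close>.\<close>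

definition avg_norm :: "real \<Rightarrow> 'i set \<Rightarrow> ('i \<Rightarrow> 'a::real_normed_vector) \<Rightarrow> real"
  where "avg_norm p I F = ((\<Sum>i\<in>I. norm (F i) powr p) / card I) powr (1 / p)"

lemma convex_on_powr_nonneg:
  assumes "(p::real) \<ge> 1" shows "convex_on {0..} (\<lambda>x. x powr p)"
proof (rule convex_onI)
  fix t x y :: real
  assume t: "0 < t" "t < 1" and xy: "x \<in> {0..}" "y \<in> {0..}"
  have shrink: "s powr p \<le> s" if "0 < s" "s < 1" for s :: real
    using powr_mono'[of 1 p s] assms that by simp
  consider "x = 0" | "y = 0" | "x > 0" "y > 0" using xy by fastforce
  then show "((1 - t) *\<^sub>R x + t *\<^sub>R y) powr p \<le> (1 - t) * x powr p + t * y powr p"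
  proof cases
    case 1
    then show ?thesis using t xy shrink[of t] by (simp add: powr_mult mult_right_mono)
  next
    case 2
    then show ?thesis using t xy shrink[of "1 - t"] by (simp add: powr_mult mult_right_mono)
  next
    case 3
    then show ?thesis using convex_onD[OF powr_convex[OF assms], of t x y] t by simp
  qed
qed simp

lemma avg_norm_nonneg: "0 \<le> avg_norm p I F"
  by (simp add: avg_norm_def)

lemma avg_norm_powr:
  assumes "p > 0"
  shows "avg_norm p I F powr p = (\<Sum>i\<in>I. norm (F i) powr p) / card I"
  using assms by (simp add: avg_norm_def powr_powr sum_nonneg)

lemma avg_norm_cong: "(\<And>i. i \<in> I \<Longrightarrow> norm (F i) = norm (G i)) \<Longrightarrow> avg_norm p I F = avg_norm p I G"
  by (simp add: avg_norm_def)

lemma avg_norm_mono: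
  assumes "p > 0" "\<And>i. i \<in> I \<Longrightarrow> norm (F i) \<le> norm (G i)"
  shows "avg_norm p I F \<le> avg_norm p I G"
  unfolding avg_norm_def using assms
  by (intro powr_mono2 divide_right_mono sum_mono) (auto intro!: sum_nonneg divide_nonneg_nonneg)

lemma avg_norm_scale:
  assumes "p > 0" "\<And>i. i \<in> I \<Longrightarrow> norm (F i) = c * norm (G i)" "c \<ge> 0"
  shows "avg_norm p I F = c * avg_norm p I G"
proof -
  have "(\<Sum>i\<in>I. norm (F i) powr p) = c powr p * (\<Sum>i\<in>I. norm (G i) powr p)"
    using assms by (simp add: sum_distrib_left powr_mult)
  then have "avg_norm p I F = (c powr p * ((\<Sum>i\<in>I. norm (G i) powr p) / card I)) powr (1 / p)"
    by (simp add: avg_norm_def)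
  also have "\<dots> = (c powr p) powr (1 / p) * avg_norm p I G"
    unfolding avg_norm_def by (intro powr_mult)
  also have "(c powr p) powr (1 / p) = c"
    using assms by (simp add: powr_powr)
  finally show ?thesis .
qed

lemma avg_norm_eq_0D:
  assumes "avg_norm p I F = 0" "p > 0" "finite I" "i \<in> I"
  shows "F i = 0"
proof -
  have "card I \<noteq> 0" using assms by auto
  then have "(\<Sum>i\<in>I. norm (F i) powr p) = 0"
    using assms by (simp add: avg_norm_def)
  then have "norm (F i) powr p = 0"
    using assms by (subst (asm) sum_nonneg_eq_0_iff) auto
  then show ?thesis by simp
qed

text \<open>Minkowski's inequality. After dividing \<open>F\<close> and \<open>G\<close> by their norms \<open>a\<close> and \<open>b\<close>, it is the
  convexity of \<open>x \<mapsto> x powr p\<close> with weights \<open>a / (a + b)\<close> and \<open>b / (a + b)\<close>.\<close>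

lemma avg_norm_triangle:
  assumes p: "p \<ge> 1" and I: "finite I"
  shows "avg_norm p I (\<lambda>i. F i + G i) \<le> avg_norm p I F + avg_norm p I G"
proof -
  define a b where "a = avg_norm p I F" and "b = avg_norm p I G"
  have nn: "a \<ge> 0" "b \<ge> 0" by (simp_all add: a_def b_def avg_norm_nonneg)
  consider "a = 0" | "b = 0" | "a > 0" "b > 0" using nn by fastforce
  then show ?thesis
  proof cases
    case 1
    then have "\<And>i. i \<in> I \<Longrightarrow> F i = 0" using avg_norm_eq_0D[of p I F] p I by (auto simp: a_def)
    then have "avg_norm p I (\<lambda>i. F i + G i) = b" unfolding b_def by (intro avg_norm_cong) auto
    then show ?thesis using nn by (simp add: a_def b_def)
  next
    case 2
    then have "\<And>i. i \<in> I \<Longrightarrow> G i = 0" using avg_norm_eq_0D[of p I G] p I by (auto simp: b_def)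
    then have "avg_norm p I (\<lambda>i. F i + G i) = a" unfolding a_def by (intro avg_norm_cong) auto
    then show ?thesis using nn by (simp add: a_def b_def)
  next
    case 3
    define t where "t = b / (a + b)"
    have t: "0 \<le> t" "t \<le> 1" "1 - t = a / (a + b)" using 3 by (auto simp: t_def field_simps)
    have pt: "norm (F i + G i) powr p
        \<le> (a + b) powr p * ((1 - t) * (norm (F i) powr p / a powr p) + t * (norm (G i) powr p / b powr p))" for i
    proof -
      let ?x = "norm (F i)" and ?y = "norm (G i)"
      have "norm (F i + G i) powr p \<le> (?x + ?y) powr p"
        using p by (intro powr_mono2 norm_triangle_ineq) auto
      also have "?x + ?y = (a + b) * ((1 - t) * (?x / a) + t * (?y / b))"
      proof -
        have "(a + b) * ((1 - t) * (?x / a)) = ?x" "(a + b) * (t * (?y / b)) = ?y"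
          unfolding t(3) using 3 by (simp_all add: t_def)
        then show ?thesis by (simp only: distrib_left)
      qed
      also have "\<dots> powr p = (a + b) powr p * ((1 - t) * (?x / a) + t * (?y / b)) powr p"
        using t 3 by (intro powr_mult)
      also have "\<dots> \<le> (a + b) powr p * ((1 - t) * (?x / a) powr p + t * (?y / b) powr p)"
        using convex_onD[OF convex_on_powr_nonneg[OF p], of t "?x / a" "?y / b"] t 3
        by (intro mult_left_mono) auto
      finally show ?thesis using 3 by (simp add: powr_divide)
    qed
    have "(\<Sum>i\<in>I. norm (F i + G i) powr p) / card I
      \<le> (\<Sum>i\<in>I. (a + b) powr p * ((1 - t) * (norm (F i) powr p / a powr p) + t * (norm (G i) powr p / b powr p))) / card I"
      by (intro divide_right_mono sum_mono pt) auto
    also have "\<dots> = (a + b) powr p * ((1 - t) * ((\<Sum>i\<in>I. norm (F i) powr p) / card I / a powr p)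
        + t * ((\<Sum>i\<in>I. norm (G i) powr p) / card I / b powr p))"
      by (simp add: sum.distrib sum_subtractf sum_distrib_left sum_divide_distrib algebra_simps add_divide_distrib diff_divide_distrib)
    also have "\<dots> = (a + b) powr p * ((1 - t) * (a powr p / a powr p) + t * (b powr p / b powr p))"
      using p by (simp only: a_def b_def avg_norm_powr)
    also have "\<dots> = (a + b) powr p" using 3 by simp
    finally have "((\<Sum>i\<in>I. norm (F i + G i) powr p) / card I) powr (1/p) \<le> ((a + b) powr p) powr (1/p)"
      using p by (intro powr_mono2) (auto intro!: sum_nonneg divide_nonneg_nonneg)
    then show ?thesis using p nn by (simp add: avg_norm_def[of p I "\<lambda>i. F i + G i"] powr_powr a_def b_def)
  qed
qed

lemma avg_norm_zero: "avg_norm p I (\<lambda>i. 0) = 0"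
  by (simp add: avg_norm_def)

lemma avg_norm_sum:
  assumes p: "p \<ge> 1" and I: "finite I" and "finite J"
  shows "avg_norm p I (\<lambda>i. \<Sum>j\<in>J. F j i) \<le> (\<Sum>j\<in>J. avg_norm p I (F j))"
  using assms(3)
proof (induction J rule: finite_induct)
  case empty
  then show ?case by (simp add: avg_norm_zero)
next
  case (insert j J)
  then show ?case
    using avg_norm_triangle[OF p I, of "F j" "\<lambda>i. \<Sum>j\<in>J. F j i"] by simp
qed

lemma avg_norm_mono_exponent:
  assumes "1 \<le> p" "p \<le> q" and I: "finite I" "I \<noteq> {}"
  shows "avg_norm p I F \<le> avg_norm q I F"
proof -
  let ?u = "\<lambda>i. norm (F i) powr p"
  have card: "card I > 0" using I by (simp add: card_gt_0_iff)
  have "(\<Sum>i\<in>I. (1 / card I) *\<^sub>R ?u i) powr (q / p) \<le> (\<Sum>i\<in>I. (1 / card I) * ?u i powr (q / p))"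
    using assms card convex_on_sum[OF I convex_on_powr_nonneg[of "q / p"], of "\<lambda>_. 1 / card I" ?u] by simp
  also have "\<dots> = (\<Sum>i\<in>I. norm (F i) powr q) / card I"
    using assms by (simp add: powr_powr sum_divide_distrib)
  also have "(\<Sum>i\<in>I. (1 / card I) *\<^sub>R ?u i) = (\<Sum>i\<in>I. ?u i) / card I"
    by (simp add: sum_divide_distrib)
  finally have "(((\<Sum>i\<in>I. ?u i) / card I) powr (q / p)) powr (1/q) \<le> ((\<Sum>i\<in>I. norm (F i) powr q) / card I) powr (1/q)"
    using assms by (intro powr_mono2) (auto)
  then show ?thesis using assms by (simp add: avg_norm_def powr_powr)
qed

lemma avg_norm_reindex:
  assumes "bij_betw h I J"
  shows "avg_norm p I (\<lambda>i. F (h i)) = avg_norm p J F"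
  using sum.reindex_bij_betw[OF assms, of "\<lambda>j. norm (F j) powr p"] bij_betw_same_card[OF assms]
  by (simp add: avg_norm_def)

lemma avg_norm_Times:
  assumes "p > 0"
  shows "avg_norm p (I \<times> J) (\<lambda>(i, j). F i j) = avg_norm p I (\<lambda>i. avg_norm p J (F i))"
proof -
  have "(\<Sum>x\<in>I \<times> J. norm ((\<lambda>(i, j). F i j) x) powr p) = (\<Sum>i\<in>I. \<Sum>j\<in>J. norm (F i j) powr p)"
    by (simp add: sum.cartesian_product case_prod_unfold)
  then show ?thesis
    using assms by (simp add: avg_norm_def[of p "I \<times> J"] avg_norm_def[of p I] avg_norm_powr avg_norm_nonneg
        card_cartesian_product sum_divide_distrib mult.commute)
qed

lemma avg_norm_const:
  assumes "p > 0" "finite I" "I \<noteq> {}"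
  shows "avg_norm p I (\<lambda>i. c) = norm c"
  using assms by (simp add: avg_norm_def card_gt_0_iff powr_powr)

lemma avg_norm_Times_swap:
  assumes "p > 0" 
  shows "avg_norm p I (\<lambda>i. avg_norm p J (F i)) = avg_norm p J (\<lambda>j. avg_norm p I (\<lambda>i. F i j))"
proof -
  have "bij_betw prod.swap (J \<times> I) (I \<times> J)" by (auto simp: bij_betw_def inj_on_def)
  from avg_norm_reindex[OF this, of p "\<lambda>(i, j). F i j"] 
  have "avg_norm p (I \<times> J) (\<lambda>(i, j). F i j) = avg_norm p (J \<times> I) (\<lambda>(j, i). F i j)"
    by (simp add: case_prod_unfold)
  then show ?thesis using assms avg_norm_Times[of p I J F] avg_norm_Times[of p J I "\<lambda>j i. F i j"] by simp
qed

section \<open>Walsh analysis and Fourier multipliers\<close>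

lemma scaleC_zero_right [simp]: "c *\<^sub>C (0::'a::complex_normed_vector) = 0"
  using norm_scaleC[of c "0::'a"] by simp

lemma scaleC_zero_left [simp]: "0 *\<^sub>C (x::'a::complex_normed_vector) = 0"
  using norm_scaleC[of 0 x] by simp

lemma scaleC_sum_right: "c *\<^sub>C (\<Sum>j\<in>J. (F j::'a::complex_normed_vector)) = (\<Sum>j\<in>J. c *\<^sub>C F j)"
  by (induction J rule: infinite_finite_induct) (simp_all add: scaleC_add_right)

lemma scaleC_sum_left: "(\<Sum>j\<in>J. c j) *\<^sub>C (x::'a::complex_normed_vector) = (\<Sum>j\<in>J. c j *\<^sub>C x)"
  by (induction J rule: infinite_finite_induct) (simp_all add: scaleC_add_left)

lemma finite_hcube [simp]: "finite (hcube n)"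
  by (auto simp: hcube_def intro!: finite_PiE)

lemma card_hcube: "card (hcube n) = 2 ^ n"
  by (simp add: hcube_def card_funcsetE numeral_2_eq_2)

lemma hcube_nonempty [simp]: "hcube n \<noteq> {}"
  using card_hcube[of n] by (metis card.empty power_eq_0_iff zero_neq_numeral)

lemma hcube_sq: "\<epsilon> \<in> hcube n \<Longrightarrow> i \<in> {1..n} \<Longrightarrow> \<epsilon> i * \<epsilon> i = 1"
  using PiE_mem[of \<epsilon> "{1..n}" "\<lambda>_. {-1,1}" i] by (auto simp: hcube_def)

lemma Lp_norm_eq_avg_norm: "Lp_norm n p f = avg_norm p (hcube n) f"
  by (simp add: Lp_norm_def avg_norm_def card_hcube)

text \<open>For a sign vector \<open>\<delta>\<close> this is the coordinatewise product with \<open>\<delta>\<close> on \<open>S\<close> only. It is a measure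
  preserving involution of the cube, which makes it the carrier of every transference argument below.\<close>

definition twist :: "nat \<Rightarrow> nat set \<Rightarrow> (nat \<Rightarrow> real) \<Rightarrow> (nat \<Rightarrow> real) \<Rightarrow> nat \<Rightarrow> real"
  where "twist n S \<delta> \<epsilon> = (\<lambda>i\<in>{1..n}. if i \<in> S then \<epsilon> i * \<delta> i else \<epsilon> i)"

lemma twist_in_hcube:
  assumes "\<epsilon> \<in> hcube n" "\<delta> \<in> hcube n" shows "twist n S \<delta> \<epsilon> \<in> hcube n"
  unfolding hcube_def
proof (rule PiE_I)
  fix i assume i: "i \<in> {1..n}"
  then have "\<epsilon> i \<in> {-1,1}" "\<delta> i \<in> {-1,1}"
    using assms unfolding hcube_def by (auto simp only: PiE_mem)
  then show "twist n S \<delta> \<epsilon> i \<in> {-1,1}" using i by (auto simp: twist_def)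
qed (auto simp: twist_def simp del: One_nat_def)

lemma twist_twist:
  assumes "\<epsilon> \<in> hcube n" "\<delta> \<in> hcube n" shows "twist n S \<delta> (twist n S \<delta> \<epsilon>) = \<epsilon>"
proof
  fix i
  show "twist n S \<delta> (twist n S \<delta> \<epsilon>) i = \<epsilon> i"
  proof (cases "i \<in> {1..n}")
    case True
    then show ?thesis using hcube_sq[OF assms(2) True] by (simp add: twist_def mult.assoc)
  next
    case False
    then show ?thesis using assms(1) PiE_arb[of \<epsilon> "{1..n}" _ i] by (auto simp: twist_def hcube_def)
  qed
qed

lemma bij_betw_twist:
  assumes "\<delta> \<in> hcube n" shows "bij_betw (twist n S \<delta>) (hcube n) (hcube n)"
  by (rule bij_betw_byWitness[where f' = "twist n S \<delta>"])
    (auto simp: twist_twist twist_in_hcube assms)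

lemma walsh_twist:
  assumes "A \<subseteq> {1..n}"
  shows "walsh A (twist n S \<delta> \<epsilon>) = walsh A \<epsilon> * walsh (A \<inter> S) \<delta>"
proof -
  have fin: "finite A" using assms finite_subset by blast
  have "walsh A (twist n S \<delta> \<epsilon>) = (\<Prod>i\<in>A. \<epsilon> i * (if i \<in> S then \<delta> i else 1))"
    unfolding walsh_def using assms by (intro prod.cong) (auto simp: twist_def)
  then show ?thesis by (simp only: prod.distrib walsh_def prod.inter_restrict[OF fin])
qed

text \<open>The sum over the cube factors over the coordinates, and a coordinate in the symmetric difference of
  \<open>A\<close> and \<open>B\<close> contributes \<open>-1 + 1\<close>.\<close>

lemma walsh_orthogonal:
  assumes "A \<subseteq> {1..n}" "B \<subseteq> {1..n}"
  shows "(\<Sum>\<epsilon>\<in>hcube n. walsh A \<epsilon> * walsh B \<epsilon>) = (if A = B then 2 ^ n else 0)"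
proof -
  let ?g = "\<lambda>i x. (if i \<in> A then x else 1) * (if i \<in> B then x else 1 :: real)"
  have "walsh A \<epsilon> * walsh B \<epsilon> = (\<Prod>i\<in>{1..n}. ?g i (\<epsilon> i))" for \<epsilon>
    unfolding walsh_def prod.distrib using assms
    by (simp add: prod.inter_restrict[symmetric] Int_absorb1)
  then have "(\<Sum>\<epsilon>\<in>hcube n. walsh A \<epsilon> * walsh B \<epsilon>) = (\<Sum>\<epsilon>\<in>hcube n. \<Prod>i\<in>{1..n}. ?g i (\<epsilon> i))"
    by simp
  also have "\<dots> = (\<Prod>i\<in>{1..n}. \<Sum>x\<in>{-1,1}. ?g i x)"
    unfolding hcube_def by (rule prod_sum_PiE[symmetric]) auto
  also have "\<dots> = (\<Prod>i\<in>{1..n}. if i \<in> A \<longleftrightarrow> i \<in> B then 2 else 0)"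
    by (intro prod.cong) auto
  also have "\<dots> = (if A = B then 2 ^ n else 0)"
  proof (cases "A = B")
    case False
    then obtain i where "i \<in> {1..n}" "(i \<in> A) \<noteq> (i \<in> B)" using assms by blast
    then show ?thesis using False by (auto intro!: prod_zero)
  qed simp
  finally show ?thesis .
qed

text \<open>This is the expansion of \<open>\<Prod>i. 1 + \<epsilon> i * \<delta> i\<close>, in which a coordinate where \<open>\<epsilon>\<close> and \<open>\<delta>\<close> differ
  gives a zero factor.\<close>

lemma walsh_complete:
  assumes "\<epsilon> \<in> hcube n" "\<delta> \<in> hcube n"
  shows "(\<Sum>A\<in>Pow {1..n}. walsh A \<epsilon> * walsh A \<delta>) = (if \<epsilon> = \<delta> then 2 ^ n else 0)"
proof -
  have "(\<Sum>A\<in>Pow {1..n}. walsh A \<epsilon> * walsh A \<delta>) = (\<Prod>i\<in>{1..n}. \<epsilon> i * \<delta> i + 1)"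
    by (simp add: prod_add walsh_def prod.distrib)
  also have "\<dots> = (if \<epsilon> = \<delta> then 2 ^ n else 0)"
  proof (cases "\<epsilon> = \<delta>")
    case True
    have "(\<Prod>i\<in>{1..n}. \<epsilon> i * \<delta> i + 1) = (\<Prod>i\<in>{1..n}. 2::real)"
      using assms hcube_sq True by (intro prod.cong) auto
    then show ?thesis using True by simp
  next
    case False
    then obtain i where i: "i \<in> {1..n}" "\<epsilon> i \<noteq> \<delta> i" 
      using assms PiE_ext unfolding hcube_def by metis
    moreover have "\<epsilon> i \<in> {-1,1}" "\<delta> i \<in> {-1,1}"
      using assms i PiE_mem unfolding hcube_def by fast+
    ultimately have "\<epsilon> i * \<delta> i + 1 = 0" by auto
    then show ?thesis using False i by (auto intro!: prod_zero)
  qed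
  finally show ?thesis .
qed

lemma fourier_inversion:
  fixes f :: "(nat \<Rightarrow> real) \<Rightarrow> 'a::real_normed_vector"
  assumes "\<epsilon> \<in> hcube n"
  shows "f \<epsilon> = (\<Sum>A\<in>Pow {1..n}. walsh A \<epsilon> *\<^sub>R fourier_coeff n f A)"
proof -
  have "(\<Sum>A\<in>Pow {1..n}. walsh A \<epsilon> *\<^sub>R fourier_coeff n f A)
      = (\<Sum>A\<in>Pow {1..n}. \<Sum>\<delta>\<in>hcube n. ((walsh A \<epsilon> * walsh A \<delta>) / 2 ^ n) *\<^sub>R f \<delta>)"
    by (simp add: fourier_coeff_def scaleR_sum_right)
  also have "\<dots> = (\<Sum>\<delta>\<in>hcube n. ((\<Sum>A\<in>Pow {1..n}. walsh A \<epsilon> * walsh A \<delta>) / 2 ^ n) *\<^sub>R f \<delta>)"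
    by (subst sum.swap) (simp add: scaleR_sum_left sum_divide_distrib)
  also have "\<dots> = (\<Sum>\<delta>\<in>hcube n. if \<epsilon> = \<delta> then f \<delta> else 0)"
    using assms by (intro sum.cong) (auto simp: walsh_complete simp del: One_nat_def)
  finally show ?thesis using assms by simp
qed

lemma fourier_coeff_cong:
  "(\<And>\<epsilon>. \<epsilon> \<in> hcube n \<Longrightarrow> f \<epsilon> = g \<epsilon>) \<Longrightarrow> fourier_coeff n f A = fourier_coeff n g A"
  by (simp add: fourier_coeff_def)

lemma fourier_coeff_walsh_sum:
  fixes v :: "'i \<Rightarrow> 'a::real_normed_vector"
  assumes "finite J" "\<And>j. j \<in> J \<Longrightarrow> T j \<subseteq> {1..n}" "B \<subseteq> {1..n}"
  shows "fourier_coeff n (\<lambda>\<epsilon>. \<Sum>j\<in>J. walsh (T j) \<epsilon> *\<^sub>R v j) B = (\<Sum>j\<in>J. if T j = B then v j else 0)"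
proof -
  have "fourier_coeff n (\<lambda>\<epsilon>. \<Sum>j\<in>J. walsh (T j) \<epsilon> *\<^sub>R v j) B
      = (\<Sum>\<epsilon>\<in>hcube n. \<Sum>j\<in>J. ((walsh B \<epsilon> * walsh (T j) \<epsilon>) / 2 ^ n) *\<^sub>R v j)"
    by (simp add: fourier_coeff_def scaleR_sum_right)
  also have "\<dots> = (\<Sum>j\<in>J. ((\<Sum>\<epsilon>\<in>hcube n. walsh B \<epsilon> * walsh (T j) \<epsilon>) / 2 ^ n) *\<^sub>R v j)"
    by (subst sum.swap) (simp add: scaleR_sum_left sum_divide_distrib)
  also have "\<dots> = (\<Sum>j\<in>J. if T j = B then v j else 0)"
    using assms by (intro sum.cong) (auto simp: walsh_orthogonal)
  finally show ?thesis .
qed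

definition multiplier ::
    "nat \<Rightarrow> (nat set \<Rightarrow> complex) \<Rightarrow> ((nat \<Rightarrow> real) \<Rightarrow> 'a::complex_normed_vector) \<Rightarrow> (nat \<Rightarrow> real) \<Rightarrow> 'a"
  where "multiplier n m f \<epsilon> = (\<Sum>A\<in>Pow {1..n}. walsh A \<epsilon> *\<^sub>R (m A *\<^sub>C fourier_coeff n f A))"

lemma fourier_coeff_multiplier:
  assumes "B \<subseteq> {1..n}"
  shows "fourier_coeff n (multiplier n m f) B = m B *\<^sub>C fourier_coeff n f B"
proof -
  have "fourier_coeff n (multiplier n m f) B
      = (\<Sum>A\<in>Pow {1..n}. if A = B then m A *\<^sub>C fourier_coeff n f A else 0)"
    unfolding multiplier_def by (rule fourier_coeff_walsh_sum) (use assms in auto)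
  then show ?thesis using assms by simp
qed

lemma multiplier_multiplier:
  "multiplier n m (multiplier n m' f) = multiplier n (\<lambda>A. m A * m' A) f"
proof
  fix \<epsilon>
  show "multiplier n m (multiplier n m' f) \<epsilon> = multiplier n (\<lambda>A. m A * m' A) f \<epsilon>"
    unfolding multiplier_def[of n m] multiplier_def[of n "\<lambda>A. m A * m' A"]
    by (intro sum.cong) (auto simp: fourier_coeff_multiplier scaleC_scaleC)
qed

lemma multiplier_cong:
  assumes "\<And>A. A \<subseteq> {1..n} \<Longrightarrow> fourier_coeff n f A = 0 \<or> m A = m' A"
  shows "multiplier n m f = multiplier n m' f"
proof
  fix \<epsilon>
  show "multiplier n m f \<epsilon> = multiplier n m' f \<epsilon>"
    unfolding multiplier_def
  proof (intro sum.cong refl)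
    fix A assume "A \<in> Pow {1..n}"
    then have "fourier_coeff n f A = 0 \<or> m A = m' A" using assms by blast
    then show "walsh A \<epsilon> *\<^sub>R (m A *\<^sub>C fourier_coeff n f A) = walsh A \<epsilon> *\<^sub>R (m' A *\<^sub>C fourier_coeff n f A)"
      by auto
  qed
qed

lemma scaleR_scaleC_commute:
  "r *\<^sub>R (c *\<^sub>C (x::'a::complex_normed_vector)) = c *\<^sub>C (r *\<^sub>R x)"
  by (simp add: scaleR_scaleC scaleC_scaleC mult.commute)

lemma multiplier_sum:
  "multiplier n (\<lambda>A. \<Sum>j\<in>J. c j * m j A) f \<epsilon> = (\<Sum>j\<in>J. c j *\<^sub>C multiplier n (m j) f \<epsilon>)"
proof -
  have "(\<Sum>j\<in>J. c j *\<^sub>C multiplier n (m j) f \<epsilon>)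
      = (\<Sum>A\<in>Pow {1..n}. \<Sum>j\<in>J. c j *\<^sub>C (walsh A \<epsilon> *\<^sub>R (m j A *\<^sub>C fourier_coeff n f A)))"
    unfolding multiplier_def scaleC_sum_right by (rule sum.swap)
  then show ?thesis
    by (simp add: multiplier_def scaleC_sum_left scaleR_sum_right scaleR_scaleC_commute scaleC_scaleC)
qed

text \<open>In the Walsh expansion of \<open>f (twist n S \<delta> \<epsilon>)\<close> the frequency \<open>A\<close> enters through
  \<open>walsh (A \<inter> S) \<delta>\<close>, so a multiplier acting in the variable \<open>\<delta>\<close> sees \<open>A \<inter> S\<close> in place of \<open>A\<close>.\<close>

lemma multiplier_twist:
  assumes \<epsilon>: "\<epsilon> \<in> hcube n" and \<delta>: "\<delta> \<in> hcube n"
  shows "multiplier n m (\<lambda>\<delta>. f (twist n S \<delta> \<epsilon>)) \<delta> = multiplier n (\<lambda>A. m (A \<inter> S)) f (twist n S \<delta> \<epsilon>)"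
proof -
  let ?P = "Pow {1..n}"
  let ?v = "\<lambda>A. walsh A \<epsilon> *\<^sub>R fourier_coeff n f A"
  have G: "f (twist n S \<delta>' \<epsilon>) = (\<Sum>A\<in>?P. walsh (A \<inter> S) \<delta>' *\<^sub>R ?v A)" if "\<delta>' \<in> hcube n" for \<delta>'
    by (subst fourier_inversion[OF twist_in_hcube[OF \<epsilon> that]])
      (intro sum.cong, auto simp: walsh_twist mult.commute)
  have fc: "fourier_coeff n (\<lambda>\<delta>. f (twist n S \<delta> \<epsilon>)) B = (\<Sum>A\<in>?P. if A \<inter> S = B then ?v A else 0)"
    if "B \<in> ?P" for B
  proof -
    have "fourier_coeff n (\<lambda>\<delta>. f (twist n S \<delta> \<epsilon>)) B
        = fourier_coeff n (\<lambda>\<delta>. \<Sum>A\<in>?P. walsh (A \<inter> S) \<delta> *\<^sub>R ?v A) B"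
      by (rule fourier_coeff_cong) (rule G)
    also have "\<dots> = (\<Sum>A\<in>?P. if A \<inter> S = B then ?v A else 0)"
      by (rule fourier_coeff_walsh_sum) (use that in auto)
    finally show ?thesis .
  qed
  have "multiplier n m (\<lambda>\<delta>. f (twist n S \<delta> \<epsilon>)) \<delta>
      = (\<Sum>B\<in>?P. \<Sum>A\<in>?P. if A \<inter> S = B then walsh B \<delta> *\<^sub>R (m B *\<^sub>C ?v A) else 0)"
    unfolding multiplier_def
    by (intro sum.cong refl)
      (auto simp: fc scaleC_sum_right scaleR_sum_right if_distrib cong: if_cong)
  also have "\<dots> = (\<Sum>A\<in>?P. \<Sum>B\<in>?P. if A \<inter> S = B then walsh B \<delta> *\<^sub>R (m B *\<^sub>C ?v A) else 0)"
    by (rule sum.swap)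
  also have "\<dots> = (\<Sum>A\<in>?P. walsh (A \<inter> S) \<delta> *\<^sub>R (m (A \<inter> S) *\<^sub>C ?v A))"
    by (intro sum.cong refl) (auto simp: sum.delta')
  also have "\<dots> = multiplier n (\<lambda>A. m (A \<inter> S)) f (twist n S \<delta> \<epsilon>)"
    unfolding multiplier_def
    by (intro sum.cong refl) (auto simp: walsh_twist scaleR_scaleC_commute[symmetric] mult.commute)
  finally show ?thesis .
qed

lemma avg_norm_twist:
  fixes g :: "(nat \<Rightarrow> real) \<Rightarrow> 'a::real_normed_vector"
  assumes "p > 0"
  shows "avg_norm p (hcube n) (\<lambda>\<delta>. avg_norm p (hcube n) (\<lambda>\<epsilon>. g (twist n S \<delta> \<epsilon>))) = avg_norm p (hcube n) g"
proof -
  have "avg_norm p (hcube n) (\<lambda>\<delta>. avg_norm p (hcube n) (\<lambda>\<epsilon>. g (twist n S \<delta> \<epsilon>)))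
      = avg_norm p (hcube n) (\<lambda>\<delta>. avg_norm p (hcube n) g)"
    by (intro avg_norm_cong) (simp add: avg_norm_reindex[OF bij_betw_twist])
  then show ?thesis using assms by (simp add: avg_norm_const avg_norm_nonneg)
qed

lemma avg_norm_twist_swap:
  fixes g :: "(nat \<Rightarrow> real) \<Rightarrow> 'a::real_normed_vector"
  assumes "p > 0"
  shows "avg_norm p (hcube n) (\<lambda>\<epsilon>. avg_norm p (hcube n) (\<lambda>\<delta>. g (twist n S \<delta> \<epsilon>))) = avg_norm p (hcube n) g"
  using avg_norm_Times_swap[OF assms, of "hcube n" "hcube n" "\<lambda>\<epsilon> \<delta>. g (twist n S \<delta> \<epsilon>)"] avg_norm_twist[OF assms, of n g S]
  by (rule trans)

definition multiplier_bound :: "'a::complex_normed_vector itself \<Rightarrow> nat \<Rightarrow> real \<Rightarrow> (nat set \<Rightarrow> complex) \<Rightarrow> real \<Rightarrow> bool"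
  where "multiplier_bound _ n p m B \<longleftrightarrow>
    (\<forall>f :: (nat \<Rightarrow> real) \<Rightarrow> 'a. avg_norm p (hcube n) (multiplier n m f) \<le> B * avg_norm p (hcube n) f)"

lemma multiplier_bound_cong:
  fixes T :: "'a::complex_normed_vector itself"
  assumes "\<And>A. A \<subseteq> {1..n} \<Longrightarrow> m A = m' A" "multiplier_bound T n p m B"
  shows "multiplier_bound T n p m' B"
proof -
  have "multiplier n m f = multiplier n m' f" for f :: "(nat \<Rightarrow> real) \<Rightarrow> 'a"
    using assms(1) by (intro multiplier_cong) auto
  then show ?thesis using assms(2) by (simp add: multiplier_bound_def)
qed

lemma multiplier_bound_mono:
  fixes T :: "'a::complex_normed_vector itself"
  assumes "multiplier_bound T n p m B" "B \<le> B'"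
  shows "multiplier_bound T n p m B'"
  unfolding multiplier_bound_def
proof
  fix f :: "(nat \<Rightarrow> real) \<Rightarrow> 'a"
  have "avg_norm p (hcube n) (multiplier n m f) \<le> B * avg_norm p (hcube n) f"
    using assms(1) by (simp add: multiplier_bound_def)
  also have "\<dots> \<le> B' * avg_norm p (hcube n) f"
    using assms(2) by (intro mult_right_mono avg_norm_nonneg)
  finally show "avg_norm p (hcube n) (multiplier n m f) \<le> B' * avg_norm p (hcube n) f" .
qed

text \<open>Transference: for fixed \<open>\<epsilon>\<close> the bound for \<open>m\<close> applies to \<open>\<delta> \<mapsto> f (twist n S \<delta> \<epsilon>)\<close>. Averaging over
  \<open>\<epsilon>\<close> and using that the twist preserves the measure removes \<open>\<delta>\<close> again. With \<open>m = level 1\<close> this is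
  the Rademacher projection in the coordinates from \<open>S\<close> alone.\<close>

lemma multiplier_bound_restrict:
  fixes T :: "'a::complex_normed_vector itself"
  assumes p: "p > 0" and B: "multiplier_bound T n p m B" "B \<ge> 0"
  shows "multiplier_bound T n p (\<lambda>A. m (A \<inter> S)) B"
  unfolding multiplier_bound_def
proof
  fix f :: "(nat \<Rightarrow> real) \<Rightarrow> 'a"
  let ?H = "hcube n" and ?M = "multiplier n (\<lambda>A. m (A \<inter> S)) f"
  have "avg_norm p ?H ?M = avg_norm p ?H (\<lambda>\<epsilon>. avg_norm p ?H (\<lambda>\<delta>. ?M (twist n S \<delta> \<epsilon>)))"
    by (rule avg_norm_twist_swap[OF p, symmetric])
  also have "\<dots> = avg_norm p ?H (\<lambda>\<epsilon>. avg_norm p ?H (multiplier n m (\<lambda>\<delta>. f (twist n S \<delta> \<epsilon>))))"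
    by (intro avg_norm_cong arg_cong[of _ _ norm]) (simp add: multiplier_twist)
  also have "\<dots> \<le> avg_norm p ?H (\<lambda>\<epsilon>. B * avg_norm p ?H (\<lambda>\<delta>. f (twist n S \<delta> \<epsilon>)))"
    using B p by (intro avg_norm_mono) (auto simp: multiplier_bound_def avg_norm_nonneg)
  also have "\<dots> = B * avg_norm p ?H (\<lambda>\<epsilon>. avg_norm p ?H (\<lambda>\<delta>. f (twist n S \<delta> \<epsilon>)))"
    using p B by (intro avg_norm_scale) (auto simp: abs_mult)
  also have "\<dots> = B * avg_norm p ?H f"
    by (simp only: avg_norm_twist_swap[OF p])
  finally show "avg_norm p ?H ?M \<le> B * avg_norm p ?H f" .
qed

lemma multiplier_bound_comp:
  fixes T :: "'a::complex_normed_vector itself"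
  assumes "multiplier_bound T n p m B" "multiplier_bound T n p m' B'" "B \<ge> 0"
  shows "multiplier_bound T n p (\<lambda>A. m A * m' A) (B * B')"
  unfolding multiplier_bound_def multiplier_multiplier[symmetric]
proof
  fix f :: "(nat \<Rightarrow> real) \<Rightarrow> 'a"
  have "avg_norm p (hcube n) (multiplier n m (multiplier n m' f)) \<le> B * avg_norm p (hcube n) (multiplier n m' f)"
    using assms by (simp add: multiplier_bound_def)
  also have "\<dots> \<le> B * (B' * avg_norm p (hcube n) f)"
    using assms by (intro mult_left_mono) (simp_all add: multiplier_bound_def)
  finally show "avg_norm p (hcube n) (multiplier n m (multiplier n m' f)) \<le> B * B' * avg_norm p (hcube n) f"
    by simp
qed

lemma multiplier_bound_sum:
  fixes T :: "'a::complex_normed_vector itself"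
  assumes "p \<ge> 1" "finite J" "\<And>j. j \<in> J \<Longrightarrow> multiplier_bound T n p (m j) (B j)"
  shows "multiplier_bound T n p (\<lambda>A. \<Sum>j\<in>J. c j * m j A) (\<Sum>j\<in>J. cmod (c j) * B j)"
  unfolding multiplier_bound_def
proof
  fix f :: "(nat \<Rightarrow> real) \<Rightarrow> 'a"
  let ?H = "hcube n"
  have "avg_norm p ?H (multiplier n (\<lambda>A. \<Sum>j\<in>J. c j * m j A) f)
      = avg_norm p ?H (\<lambda>\<epsilon>. \<Sum>j\<in>J. c j *\<^sub>C multiplier n (m j) f \<epsilon>)"
    by (simp add: multiplier_sum[abs_def])
  also have "\<dots> \<le> (\<Sum>j\<in>J. avg_norm p ?H (\<lambda>\<epsilon>. c j *\<^sub>C multiplier n (m j) f \<epsilon>))"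
    using assms by (intro avg_norm_sum) auto
  also have "\<dots> = (\<Sum>j\<in>J. cmod (c j) * avg_norm p ?H (multiplier n (m j) f))"
    using assms by (intro sum.cong refl avg_norm_scale) (auto simp: norm_scaleC)
  also have "\<dots> \<le> (\<Sum>j\<in>J. cmod (c j) * (B j * avg_norm p ?H f))"
    using assms by (intro sum_mono mult_left_mono) (auto simp: multiplier_bound_def)
  finally show "avg_norm p ?H (multiplier n (\<lambda>A. \<Sum>j\<in>J. c j * m j A) f) \<le> (\<Sum>j\<in>J. cmod (c j) * B j) * avg_norm p ?H f"
    by (simp add: sum_distrib_right mult.assoc)
qed

lemma multiplier_bound_unscale:
  assumes p: "p \<ge> 1" and b: "multiplier_bound T n p (\<lambda>A. of_real w * m A) B" and w: "w > 0"
  shows "multiplier_bound T n p m (B / w)"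
proof -
  have "multiplier_bound T n p (\<lambda>A. \<Sum>j\<in>{()}. of_real (1 / w) * (of_real w * m A)) (\<Sum>j\<in>{()}. cmod (of_real (1 / w)) * B)"
    by (intro multiplier_bound_sum b p) auto
  moreover have "of_real (1 / w) * (of_real w * m A) = m A" for A
    using w by simp
  moreover have "cmod (of_real (1 / w)) * B = B / w"
    using w by (simp add: norm_divide)
  ultimately show ?thesis by simp
qed

section \<open>Random coordinate sets and the cone of bounded noise operators\<close>

text \<open>The probability that a random subset of \<open>N\<close>, containing each point independently with probability
  \<open>q\<close>, equals \<open>S\<close>.\<close>

definition subset_weight :: "'i set \<Rightarrow> real \<Rightarrow> 'i set \<Rightarrow> real"
  where "subset_weight N q S = q ^ card S * (1 - q) ^ card (N - S)"

text \<open>The trace on \<open>A\<close> of a random subset of \<open>N\<close> is a random subset of \<open>A\<close> with the same \<open>q\<close>.\<close>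

lemma subset_weight_inter:
  fixes \<phi> :: "'i set \<Rightarrow> complex"
  assumes N: "finite N" and A: "A \<subseteq> N"
  shows "(\<Sum>S\<in>Pow N. of_real (subset_weight N q S) * \<phi> (A \<inter> S)) = (\<Sum>U\<in>Pow A. of_real (subset_weight A q U) * \<phi> U)"
proof -
  have fA: "finite A" using N A finite_subset by blast
  have pr: "(\<Sum>S\<in>Pow N. if A \<inter> S = U then subset_weight N q S else 0) = subset_weight A q U" if U: "U \<in> Pow A" for U
  proof -
    let ?f = "\<lambda>i. if i \<in> A \<and> i \<notin> U then 0 else q" and ?g = "\<lambda>i. if i \<in> U then 0 else 1 - q"
    have "(\<Prod>i\<in>S. ?f i) * (\<Prod>i\<in>N - S. ?g i) = (if A \<inter> S = U then subset_weight N q S else 0)" if S: "S \<in> Pow N" for S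
    proof (cases "A \<inter> S = U")
      case True
      have "(\<Prod>i\<in>S. ?f i) = (\<Prod>i\<in>S. q)" "(\<Prod>i\<in>N - S. ?g i) = (\<Prod>i\<in>N - S. 1 - q)"
        using True by (auto intro!: prod.cong)
      then show ?thesis using True by (simp add: subset_weight_def)
    next
      case False
      then consider i where "i \<in> A" "i \<in> S" "i \<notin> U" | i where "i \<in> U" "i \<notin> S" using U by blast
      then have "(\<Prod>i\<in>S. ?f i) = 0 \<or> (\<Prod>i\<in>N - S. ?g i) = 0"
      proof cases
        case 1
        then have "(\<Prod>i\<in>S. ?f i) = 0" using S N finite_subset by (intro prod_zero) auto
        then show ?thesis ..
      next
        case 2
        then have "(\<Prod>i\<in>N - S. ?g i) = 0" using U A N by (intro prod_zero) auto
        then show ?thesis ..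
      qed
      then show ?thesis using False by auto
    qed
    then have "(\<Sum>S\<in>Pow N. if A \<inter> S = U then subset_weight N q S else 0) = (\<Sum>S\<in>Pow N. (\<Prod>i\<in>S. ?f i) * (\<Prod>i\<in>N - S. ?g i))"
      by (intro sum.cong) auto
    also have "\<dots> = (\<Prod>i\<in>N. ?f i + ?g i)" using N by (rule prod_add[symmetric])
    also have "\<dots> = (\<Prod>i\<in>A. ?f i + ?g i)" using N A U by (intro prod.mono_neutral_right) auto
    also have "\<dots> = (\<Prod>i\<in>U. ?f i + ?g i) * (\<Prod>i\<in>A - U. ?f i + ?g i)"
      using U fA by (metis (lifting) PowD mult.commute prod.subset_diff)
    also have "\<dots> = (\<Prod>i\<in>U. q) * (\<Prod>i\<in>A - U. 1 - q)"
      by (intro arg_cong2[where f="(*)"] prod.cong) auto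
    finally show ?thesis by (simp add: subset_weight_def)
  qed
  have "(\<Sum>S\<in>Pow N. of_real (subset_weight N q S) * \<phi> (A \<inter> S))
      = (\<Sum>S\<in>Pow N. \<Sum>U\<in>Pow A. if A \<inter> S = U then of_real (subset_weight N q S) * \<phi> U else 0)"
    using fA by (intro sum.cong) (auto simp: sum.delta')
  also have "\<dots> = (\<Sum>U\<in>Pow A. \<Sum>S\<in>Pow N. if A \<inter> S = U then of_real (subset_weight N q S) * \<phi> U else 0)"
    by (rule sum.swap)
  also have "\<dots> = (\<Sum>U\<in>Pow A. of_real (\<Sum>S\<in>Pow N. if A \<inter> S = U then subset_weight N q S else 0) * \<phi> U)"
    unfolding of_real_sum sum_distrib_right by (intro sum.cong refl) auto
  also have "\<dots> = (\<Sum>U\<in>Pow A. of_real (subset_weight A q U) * \<phi> U)"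
    using pr by (intro sum.cong) auto
  finally show ?thesis .
qed

lemma sum_subset_weight:
  assumes "finite N" shows "(\<Sum>S\<in>Pow N. subset_weight N q S) = 1"
  using prod_add[OF assms, of "\<lambda>_. q" "\<lambda>_. 1 - q"] by (simp add: subset_weight_def)

lemma subset_weight_nonneg: "0 \<le> q \<Longrightarrow> q \<le> 1 \<Longrightarrow> 0 \<le> subset_weight N q S"
  by (simp add: subset_weight_def)

lemma multiplier_bound_average:
  assumes "p \<ge> 1" "0 \<le> q" "q \<le> 1" "\<And>S. S \<subseteq> {1..n} \<Longrightarrow> multiplier_bound T n p (\<lambda>A. m S A) B"
  shows "multiplier_bound T n p (\<lambda>A. \<Sum>S\<in>Pow {1..n}. of_real (subset_weight {1..n} q S) * m S A) B"
proof -
  have "multiplier_bound T n p (\<lambda>A. \<Sum>S\<in>Pow {1..n}. of_real (subset_weight {1..n} q S) * m S A)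
      (\<Sum>S\<in>Pow {1..n}. cmod (of_real (subset_weight {1..n} q S)) * B)"
    using assms by (intro multiplier_bound_sum) auto
  also have "(\<Sum>S\<in>Pow {1..n}. cmod (of_real (subset_weight {1..n} q S)) * B) = (\<Sum>S\<in>Pow {1..n}. subset_weight {1..n} q S) * B"
    unfolding sum_distrib_right using assms by (intro sum.cong) (auto simp: subset_weight_nonneg)
  finally show ?thesis by (simp add: sum_subset_weight)
qed

text \<open>The multiplier of the projection onto the Walsh functions of degree exactly \<open>k\<close>; for \<open>k = 1\<close> it is
  the Rademacher projection.\<close>

definition level :: "nat \<Rightarrow> nat set \<Rightarrow> complex"
  where "level k A = (if card A = k then 1 else 0)"

lemma multiplier_bound_level_0:
  fixes T :: "'a::complex_normed_vector itself"
  assumes p: "p \<ge> 1" shows "multiplier_bound T n p (level 0) 1"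
  unfolding multiplier_bound_def
proof
  fix f :: "(nat \<Rightarrow> real) \<Rightarrow> 'a"
  let ?H = "hcube n"
  have "multiplier n (level 0) f \<epsilon> = (\<Sum>A\<in>Pow {1..n}. if A = {} then fourier_coeff n f A else 0)" for \<epsilon>
    unfolding multiplier_def
    by (intro sum.cong) (auto simp: level_def walsh_def scaleC_one dest: finite_subset[OF _ finite_atLeastAtMost])
  then have "avg_norm p ?H (multiplier n (level 0) f) = avg_norm p ?H (\<lambda>_. fourier_coeff n f {})"
    by (intro avg_norm_cong) simp
  also have "\<dots> = norm (fourier_coeff n f {})"
    using p by (simp add: avg_norm_const)
  also have "\<dots> \<le> avg_norm 1 ?H f"
    using norm_sum[of f ?H]
    by (simp add: fourier_coeff_def walsh_def avg_norm_def card_hcube sum_nonneg divide_right_mono)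
  also have "\<dots> \<le> avg_norm p ?H f"
    using p by (intro avg_norm_mono_exponent) auto
  finally show "avg_norm p ?H (multiplier n (level 0) f) \<le> 1 * avg_norm p ?H f" by simp
qed

text \<open>For each \<open>S\<close>, apply the Rademacher projection in the coordinates of \<open>S\<close> and the level-\<open>k\<close> projection
  in the others. Averaged over random \<open>S\<close>, the product multiplier keeps exactly the frequencies with
  \<open>Suc k\<close> elements, with factor \<open>Suc k * q * (1 - q) ^ k\<close>. The choice \<open>q = 1 / Suc k\<close> makes the
  factor at least \<open>1 / exp 1\<close>.\<close>

lemma multiplier_bound_level_Suc:
  assumes p: "p \<ge> 1" and K: "multiplier_bound T n p (level 1) K" "K \<ge> 0"
    and L: "multiplier_bound T n p (level k) L" "L \<ge> 0"
  shows "multiplier_bound T n p (level (Suc k)) (exp 1 * K * L)"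
proof -
  (* This q maximises the factor Suc k * q * (1 - q) ^ k. *)
  define q where "q = 1 / real (Suc k)"
  have q: "0 \<le> q" "q \<le> 1" by (auto simp: q_def)
  let ?N = "{1..n}"
  let ?m = "\<lambda>S A. level 1 (A \<inter> S) * level k (A \<inter> (- S))"
  have "multiplier_bound T n p (\<lambda>A. \<Sum>S\<in>Pow ?N. of_real (subset_weight ?N q S) * ?m S A) (K * L)"
    using assms q by (intro multiplier_bound_average multiplier_bound_comp multiplier_bound_restrict) auto
  then have b1: "multiplier_bound T n p (\<lambda>A. of_real ((1 - q) ^ k) * level (Suc k) A) (K * L)"
  proof (rule multiplier_bound_cong[rotated])
    fix A assume A: "A \<subseteq> ?N"
    then have fA: "finite A" using finite_subset by blast
    have "(\<Sum>S\<in>Pow ?N. of_real (subset_weight ?N q S) * ?m S A)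
        = (\<Sum>S\<in>Pow ?N. of_real (subset_weight ?N q S) * (level 1 (A \<inter> S) * level k (A - (A \<inter> S))))"
      by (intro sum.cong refl) (simp add: Diff_eq Int_assoc Int_Un_distrib)
    also have "\<dots> = (\<Sum>U\<in>Pow A. of_real (subset_weight A q U) * (level 1 U * level k (A - U)))"
      using A by (intro subset_weight_inter) auto
    also have "\<dots> = (\<Sum>U\<in>(\<lambda>i. {i}) ` A. of_real (subset_weight A q U) * (level 1 U * level k (A - U)))"
      using fA by (intro sum.mono_neutral_right) (auto simp: level_def card_1_singleton_iff)
    also have "\<dots> = (\<Sum>i\<in>A. of_real (subset_weight A q {i}) * level k (A - {i}))"
      by (subst sum.reindex) (auto simp: level_def)
    also have "\<dots> = (\<Sum>i\<in>A. of_real (q * (1 - q) ^ k) * level (Suc k) A)"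
    proof (rule sum.cong[OF refl])
      fix i assume i: "i \<in> A"
      then have "card A > 0" using fA card_gt_0_iff by blast
      then show "of_real (subset_weight A q {i}) * level k (A - {i}) = of_real (q * (1 - q) ^ k) * level (Suc k) A"
        using i fA by (auto simp: level_def subset_weight_def)
    qed
    also have "\<dots> = of_real ((1 - q) ^ k) * level (Suc k) A"
      by (simp add: level_def q_def del: of_nat_Suc)
    finally show "(\<Sum>S\<in>Pow ?N. of_real (subset_weight ?N q S) * ?m S A) = of_real ((1 - q) ^ k) * level (Suc k) A" .
  qed
  have e: "1 \<le> exp 1 * (1 - q) ^ k"
  proof (cases "k = 0")
    case False
    have "1 + 1 / k \<le> exp (1 / k)" by (rule exp_ge_add_one_self)
    then have "(1 + 1 / k) ^ k \<le> exp (1 / k) ^ k" by (intro power_mono) auto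
    also have "\<dots> = exp 1" using False by (simp flip: exp_of_nat_mult)
    finally have "(1 + 1 / k) ^ k * (1 - q) ^ k \<le> exp 1 * (1 - q) ^ k" using q by (intro mult_right_mono) auto
    moreover have "1 - q = k / (k + 1)" "1 + 1 / k = (k + 1) / k"
      using False by (simp_all add: q_def field_simps)
    then have "(1 + 1 / k) * (1 - q) = 1" using False by simp
    ultimately show ?thesis by (simp flip: power_mult_distrib)
  qed simp
  have "(1 - q) ^ k \<noteq> 0"
  proof
    assume "(1 - q) ^ k = 0"
    then show False using e by (simp only: mult_zero_right)
  qed
  moreover have "(1 - q) ^ k \<ge> 0" using q by (intro zero_le_power) simp
  ultimately have pos: "(1 - q) ^ k > 0" by linarith
  have "K * L \<le> exp 1 * (1 - q) ^ k * (K * L)" using mult_right_mono[OF e, of "K * L"] K L by simp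
  then have "K * L / (1 - q) ^ k \<le> exp 1 * K * L" using pos by (simp add: divide_le_eq mult_ac)
  with multiplier_bound_unscale[OF p b1 pos] show ?thesis by (rule multiplier_bound_mono)
qed

lemma multiplier_bound_level:
  assumes p: "p \<ge> 1" and K: "multiplier_bound T n p (level 1) K" "K \<ge> 0"
  shows "multiplier_bound T n p (level k) ((exp 1 * K) ^ k)"
proof (induction k)
  case 0
  then show ?case using multiplier_bound_level_0[OF p] by simp
next
  case (Suc k)
  from multiplier_bound_level_Suc[OF p K Suc] K show ?case by (simp add: mult.assoc)
qed

text \<open>The exponential growth of the level projections leaves a geometric series.\<close>

lemma multiplier_bound_small_power:
  assumes p: "p \<ge> 1" and K: "multiplier_bound T n p (level 1) K" "K \<ge> 0"
    and \<sigma>: "cmod \<sigma> * (exp 1 * K) \<le> 1 / 2"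
  shows "multiplier_bound T n p (\<lambda>A. \<sigma> ^ card A) 2"
proof -
  let ?L = "exp 1 * K"
  have "multiplier_bound T n p (\<lambda>A. \<Sum>k\<le>n. \<sigma> ^ k * level k A) (\<Sum>k\<le>n. cmod (\<sigma> ^ k) * ?L ^ k)"
    by (intro multiplier_bound_sum multiplier_bound_level assms) auto
  then have "multiplier_bound T n p (\<lambda>A. \<sigma> ^ card A) (\<Sum>k\<le>n. cmod (\<sigma> ^ k) * ?L ^ k)"
  proof (rule multiplier_bound_cong[rotated])
    fix A assume "A \<subseteq> {1..n}"
    then have "card A \<le> n" using card_mono[of "{1..n}" A] by simp
    then show "(\<Sum>k\<le>n. \<sigma> ^ k * level k A) = \<sigma> ^ card A"
      by (simp add: level_def if_distrib cong: if_cong)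
  qed
  then show ?thesis
  proof (rule multiplier_bound_mono)
    have "(\<Sum>k\<le>n. cmod (\<sigma> ^ k) * ?L ^ k) = (\<Sum>k\<le>n. (cmod \<sigma> * ?L) ^ k)"
      by (simp add: power_mult_distrib norm_power)
    also have "\<dots> \<le> (\<Sum>k\<le>n. (1 / 2) ^ k)"
      using \<sigma> K by (intro sum_mono power_mono) auto
    also have "\<dots> \<le> 2"
    proof -
      have "(\<Sum>k\<le>n. (1 / 2 :: real) ^ k) / 2 = 1 - (1 / 2) ^ Suc n"
        using sum_gp_basic[of "1 / 2 :: real" n] by simp
      moreover have "0 \<le> (1 / 2 :: real) ^ Suc n" by (rule zero_le_power) simp
      ultimately show ?thesis by linarith
    qed
    finally show "(\<Sum>k\<le>n. cmod (\<sigma> ^ k) * ?L ^ k) \<le> 2" .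
  qed
qed

text \<open>Applying the noise operator with complex parameter \<open>\<sigma>\<close> in a random set of coordinates of density
  \<open>q\<close>, and averaging, yields the noise operator with parameter \<open>1 - q * (1 - \<sigma>)\<close>. Hence a bound on the
  disc of radius \<open>1 / (2 * exp 1 * K)\<close> spreads to its convex hull with \<open>1\<close>, which has an angle
  at \<open>1\<close>. This is the analyticity of the heat semigroup on a sector, in the form in which it is
  used.\<close>

lemma multiplier_bound_cone:
  assumes p: "p \<ge> 1" and K: "multiplier_bound T n p (level 1) K" "K \<ge> 0"
    and \<sigma>: "cmod \<sigma> * (exp 1 * K) \<le> 1 / 2" and q: "0 \<le> q" "q \<le> 1"
  shows "multiplier_bound T n p (\<lambda>A. (1 - of_real q * (1 - \<sigma>)) ^ card A) 2"
proof -
  let ?N = "{1..n}"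
  have "multiplier_bound T n p (\<lambda>A. \<Sum>S\<in>Pow ?N. of_real (subset_weight ?N q S) * \<sigma> ^ card (A \<inter> S)) 2"
    using assms by (intro multiplier_bound_average multiplier_bound_restrict[of p T n "\<lambda>A. \<sigma> ^ card A"] multiplier_bound_small_power) auto
  then show ?thesis
  proof (rule multiplier_bound_cong[rotated])
    fix A assume A: "A \<subseteq> ?N"
    then have fA: "finite A" using finite_subset by blast
    have "(\<Sum>S\<in>Pow ?N. of_real (subset_weight ?N q S) * \<sigma> ^ card (A \<inter> S))
        = (\<Sum>U\<in>Pow A. of_real (subset_weight A q U) * \<sigma> ^ card U)"
      using A by (intro subset_weight_inter[of ?N A q "\<lambda>U. \<sigma> ^ card U"]) auto
    also have "\<dots> = (\<Sum>U\<in>Pow A. (\<Prod>i\<in>U. of_real q * \<sigma>) * (\<Prod>i\<in>A - U. 1 - of_real q))"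
      by (intro sum.cong) (auto simp: subset_weight_def power_mult_distrib mult_ac)
    also have "\<dots> = (\<Prod>i\<in>A. of_real q * \<sigma> + (1 - of_real q))"
      using fA by (rule prod_add[symmetric])
    also have "\<dots> = (1 - of_real q * (1 - \<sigma>)) ^ card A" by (simp add: algebra_simps)
    finally show "(\<Sum>S\<in>Pow ?N. of_real (subset_weight ?N q S) * \<sigma> ^ card (A \<inter> S)) = (1 - of_real q * (1 - \<sigma>)) ^ card A" .
  qed
qed

section \<open>Hypercontractivity and independence of the exponent\<close>

lemma one_plus_powr_Taylor:
  fixes y q :: real
  assumes "-1 < y"
  shows "\<exists>t. \<bar>t\<bar> \<le> \<bar>y\<bar> \<and> t * y \<ge> 0 \<and> (1 + y) powr q = 1 + q * y + q * (q - 1) / 2 * (1 + t) powr (q - 2) * y ^ 2"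
proof (cases "y = 0")
  case False
  define D where "D = (\<lambda>(m::nat) t :: real. if m = 0 then (1 + t) powr q
    else if m = 1 then q * (1 + t) powr (q - 1) else q * ((q - 1) * (1 + t) powr (q - 2)))"
  have "\<forall>m t. m < 2 \<and> min 0 y \<le> t \<and> t \<le> max 0 y \<longrightarrow> DERIV (D m) t :> D (Suc m) t"
  proof (intro allI impI)
    fix m :: nat and t :: real
    assume a: "m < 2 \<and> min 0 y \<le> t \<and> t \<le> max 0 y"
    then have t: "1 + t > 0" using assms by (auto simp: min_def max_def split: if_splits)
    consider "m = 0" | "m = 1" using a by linarith
    then show "DERIV (D m) t :> D (Suc m) t"
      using t by cases (auto simp: D_def intro!: derivative_eq_intros)
  qed
  from Taylor[of 2 D "D 0" "min 0 y" "max 0 y" 0 y, OF _ _ this] False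
  obtain t where t: "if y < 0 then y < t \<and> t < 0 else 0 < t \<and> t < y"
    and eq: "D 0 y = (\<Sum>m<2. D m 0 / fact m * (y - 0) ^ m) + D 2 t / fact 2 * (y - 0) ^ 2" by auto
  have "\<bar>t\<bar> \<le> \<bar>y\<bar>" "t * y \<ge> 0" using t False by (auto split: if_splits simp: zero_le_mult_iff)
  moreover have "(1 + y) powr q = 1 + q * y + q * (q - 1) / 2 * (1 + t) powr (q - 2) * y ^ 2"
    using eq by (simp add: D_def numeral_2_eq_2)
  ultimately show ?thesis by blast
qed (auto intro!: exI[of _ 0])

text \<open>Only one of the two summands is expanded to second order: \<open>(1 - x) powr p\<close> is
  singular at \<open>x = 1\<close>, and for it the tangent line at \<open>0\<close> suffices.\<close>

lemma symmetric_power_mean_lower: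
  fixes p x :: real
  assumes p: "p > 1" and x: "\<bar>x\<bar> \<le> 1"
  shows "1 + p * (p - 1) / 8 * x ^ 2 \<le> ((1 + x) powr p + (1 - x) powr p) / 2"
proof -
  have main: "1 + p * (p - 1) / 8 * x ^ 2 \<le> ((1 + x) powr p + (1 - x) powr p) / 2"
    if x: "0 \<le> x" "x \<le> 1" for x :: real
  proof -
    obtain t where t: "\<bar>t\<bar> \<le> \<bar>x\<bar>" "t * x \<ge> 0"
      and eq: "(1 + x) powr p = 1 + p * x + p * (p - 1) / 2 * (1 + t) powr (p - 2) * x ^ 2"
      using one_plus_powr_Taylor[of x p] x by auto
    have "1 / 2 * x ^ 2 \<le> (1 + t) powr (p - 2) * x ^ 2"
    proof (cases "x = 0")
      case False
      then have t0: "0 \<le> t" "t \<le> 1" using t x by (auto simp: zero_le_mult_iff)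
      have "1 / 2 \<le> (1 + t) powr (-1)" using t0 by (simp add: powr_minus field_simps)
      also have "\<dots> \<le> (1 + t) powr (p - 2)" using t0 p by (intro powr_mono) auto
      finally show ?thesis by (intro mult_right_mono) auto
    qed simp
    then have "p * (p - 1) / 2 * (1 / 2 * x ^ 2) \<le> p * (p - 1) / 2 * ((1 + t) powr (p - 2) * x ^ 2)"
      using p by (intro mult_left_mono) auto
    then have plus: "1 + p * x + p * (p - 1) / 4 * x ^ 2 \<le> (1 + x) powr p"
      unfolding eq by simp
    have minus: "1 - p * x \<le> (1 - x) powr p"
    proof (cases "x = 1")
      case False
      then obtain t where eq: "(1 + - x) powr p = 1 + p * - x + p * (p - 1) / 2 * (1 + t) powr (p - 2) * (- x) ^ 2"
        using one_plus_powr_Taylor[of "- x" p] x by auto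
      have "0 \<le> p * (p - 1) / 2 * (1 + t) powr (p - 2) * (- x) ^ 2" using p by simp
      with eq show ?thesis by simp
    qed (use p in simp)
    from plus minus show ?thesis by simp
  qed
  show ?thesis
  proof (cases "0 \<le> x")
    case False
    then show ?thesis using main[of "- x"] x by (simp add: add.commute)
  qed (use main x in auto)
qed

lemma symmetric_power_mean_upper:
  fixes q y :: real
  assumes q: "q > 1" and y: "\<bar>y\<bar> \<le> 1 / 2"
  shows "((1 + y) powr q + (1 - y) powr q) / 2 \<le> 1 + 2 * q * (q - 1) * 2 powr q * y ^ 2"
proof -
  have main: "(1 + y) powr q \<le> 1 + q * y + 2 * q * (q - 1) * 2 powr q * y ^ 2" if y: "\<bar>y\<bar> \<le> 1 / 2" for y :: real
  proof -
    have "-1 < y" using y by linarith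
    from one_plus_powr_Taylor[OF this, of q]
    obtain t where t: "\<bar>t\<bar> \<le> \<bar>y\<bar>"
      and eq: "(1 + y) powr q = 1 + q * y + q * (q - 1) / 2 * (1 + t) powr (q - 2) * y ^ 2"
      by auto
    have tb: "1 / 2 \<le> 1 + t" "1 + t \<le> 2" using t y by auto
    have "(1 + t) powr (q - 2) = (1 + t) powr q / (1 + t) ^ 2"
      using tb by (simp add: powr_diff powr_numeral)
    also have "\<dots> \<le> 2 powr q / (1 / 2) ^ 2"
      using tb q by (intro frac_le powr_mono2 power_mono) auto
    finally have "(1 + t) powr (q - 2) \<le> 4 * 2 powr q" by (simp add: power2_eq_square)
    then have "q * (q - 1) / 2 * ((1 + t) powr (q - 2) * y ^ 2) \<le> q * (q - 1) / 2 * (4 * 2 powr q * y ^ 2)"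
      using q by (intro mult_left_mono mult_right_mono) auto
    also have "\<dots> = 2 * q * (q - 1) * 2 powr q * y ^ 2" by (simp add: mult_ac)
    finally show ?thesis unfolding eq by (simp add: mult_ac)
  qed
  from main[of y] main[of "- y"] y show ?thesis by simp
qed

text \<open>For \<open>u = m * (1 + x)\<close> and \<open>v = m * (1 - x)\<close> the left side is \<open>m powr q * (1 + O(r\<^sup>2 * x\<^sup>2))\<close> and the right side
  is at least \<open>m powr q * (1 + c * x\<^sup>2)\<close>; any small enough \<open>r\<close>
  therefore works.\<close>

lemma two_point_hypercontractive:
  fixes p q :: real
  assumes "1 < p" "p \<le> q"
  obtains r :: real where "0 < r" "r \<le> 1 / 2"
    "\<And>u v. 0 \<le> u \<Longrightarrow> 0 \<le> v \<Longrightarrow>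
      ((((1 + r) / 2 * u + (1 - r) / 2 * v) powr q + ((1 - r) / 2 * u + (1 + r) / 2 * v) powr q) / 2)
        \<le> ((u powr p + v powr p) / 2) powr (q / p)"
proof -
  define c C where "c = p * (p - 1) / 8" and "C = 2 * q * (q - 1) * 2 powr q"
  have cC: "c > 0" "C > 0" using assms by (auto simp: c_def C_def)
  define r where "r = min (1 / 2) (c / C)"
  have r: "0 < r" using cC by (simp add: r_def)
  have r2: "r \<le> 1 / 2" unfolding r_def by (rule min.cobounded1)
  have "C * r ^ 2 \<le> C * r" using r r2 cC by (intro mult_left_mono) (auto simp: power2_eq_square mult_left_le)
  also have "\<dots> \<le> C * (c / C)" using cC by (intro mult_left_mono) (auto simp: r_def)
  finally have Cr: "C * r ^ 2 \<le> c" using cC by simp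
  show ?thesis
  proof (rule that[OF r r2])
    fix u v :: real assume uv: "0 \<le> u" "0 \<le> v"
    show "((((1 + r) / 2 * u + (1 - r) / 2 * v) powr q + ((1 - r) / 2 * u + (1 + r) / 2 * v) powr q) / 2)
        \<le> ((u powr p + v powr p) / 2) powr (q / p)"
    proof (cases "u + v = 0")
      case True
      then have "u = 0" "v = 0" using uv by auto
      then show ?thesis using assms by simp
    next
      case False
      define m x where "m = (u + v) / 2" and "x = (u - v) / (2 * m)"
      have m: "m > 0" using uv False by (simp add: m_def)
      have mx: "m * x = (u - v) / 2" using m by (simp add: x_def)
      have x: "\<bar>x\<bar> \<le> 1" using uv m by (simp add: x_def abs_le_iff divide_le_eq minus_divide_left m_def)
      have u: "u = m * (1 + x)" and v: "v = m * (1 - x)"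
        by (simp_all add: distrib_left right_diff_distrib mx) (simp_all add: m_def field_simps)
      have e1: "(1 + r) / 2 * u + (1 - r) / 2 * v = m * (1 + r * x)"
        and e2: "(1 - r) / 2 * u + (1 + r) / 2 * v = m * (1 - r * x)"
        by (simp_all add: u v field_simps)
      have rx: "\<bar>r * x\<bar> \<le> 1 / 2" using mult_mono[of r "1/2" "\<bar>x\<bar>" 1] r r2 x by (simp add: abs_mult)
      have "((m * (1 + r * x)) powr q + (m * (1 - r * x)) powr q) / 2
          = m powr q * (((1 + r * x) powr q + (1 - r * x) powr q) / 2)"
        unfolding powr_mult by (simp add: field_simps)
      also have "\<dots> \<le> m powr q * (1 + C * (r * x) ^ 2)"
        using symmetric_power_mean_upper[of q "r * x"] rx assms by (intro mult_left_mono) (auto simp: C_def)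
      also have "\<dots> \<le> m powr q * (1 + c * x ^ 2)"
        using mult_right_mono[OF Cr, of "x ^ 2"] by (intro mult_left_mono) (auto simp: power_mult_distrib mult.assoc)
      also have "\<dots> \<le> m powr q * (1 + c * x ^ 2) powr (q / p)"
        using cC assms powr_mono[of 1 "q / p" "1 + c * x ^ 2"] by (intro mult_left_mono) auto
      also have "\<dots> \<le> m powr q * (((1 + x) powr p + (1 - x) powr p) / 2) powr (q / p)"
        using symmetric_power_mean_lower[of p x] x assms cC by (intro mult_left_mono powr_mono2) (auto simp: c_def)
      also have "m powr q = (m powr p) powr (q / p)"
        using assms by (simp add: powr_powr)
      also have "(m powr p) powr (q / p) * (((1 + x) powr p + (1 - x) powr p) / 2) powr (q / p)
          = (m powr p * (((1 + x) powr p + (1 - x) powr p) / 2)) powr (q / p)"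
        by (rule powr_mult[symmetric])
      also have "m powr p * (((1 + x) powr p + (1 - x) powr p) / 2) = (u powr p + v powr p) / 2"
        unfolding u v powr_mult by (simp add: field_simps)
      finally show ?thesis unfolding e1 e2 .
    qed
  qed
qed

lemma avg_norm_norm_powr:
  assumes "p > 0" "q > 0"
  shows "avg_norm (q / p) I (\<lambda>i. norm (G i) powr p) = avg_norm q I G powr p"
  using assms by (simp add: avg_norm_def powr_powr sum_nonneg)

text \<open>Taking the larger exponent on the inside increases a mixed norm: raised to the power \<open>p\<close>, the
  inequality is the triangle inequality in \<open>L\<^sub>q\<^sub>/\<^sub>p\<close> for the functions \<open>norm (F i j) powr p\<close>.\<close>

lemma avg_norm_Minkowski:
  assumes "0 < p" "p \<le> q" "finite I" "finite J"
  shows "avg_norm q I (\<lambda>i. avg_norm p J (F i)) \<le> avg_norm p J (\<lambda>j. avg_norm q I (\<lambda>i. F i j))"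
proof -
  let ?G = "\<lambda>j i. norm (F i j) powr p / card J"
  have "avg_norm q I (\<lambda>i. avg_norm p J (F i)) powr p = avg_norm (q / p) I (\<lambda>i. norm (avg_norm p J (F i)) powr p)"
    using assms by (simp add: avg_norm_norm_powr[symmetric])
  also have "\<dots> = avg_norm (q / p) I (\<lambda>i. \<Sum>j\<in>J. ?G j i)"
    using assms by (simp add: avg_norm_nonneg avg_norm_powr sum_divide_distrib)
  also have "\<dots> \<le> (\<Sum>j\<in>J. avg_norm (q / p) I (?G j))"
    using assms by (intro avg_norm_sum) auto
  also have "\<dots> = (\<Sum>j\<in>J. 1 / card J * avg_norm (q / p) I (\<lambda>i. norm (F i j) powr p))"
    using assms by (intro sum.cong refl avg_norm_scale) auto
  also have "\<dots> = (\<Sum>j\<in>J. norm (avg_norm q I (\<lambda>i. F i j)) powr p) / card J"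
    using assms by (simp add: avg_norm_norm_powr avg_norm_nonneg sum_divide_distrib)
  also have "\<dots> = avg_norm p J (\<lambda>j. avg_norm q I (\<lambda>i. F i j)) powr p"
    using assms by (subst avg_norm_powr) auto
  finally have "(avg_norm q I (\<lambda>i. avg_norm p J (F i)) powr p) powr (1 / p)
      \<le> (avg_norm p J (\<lambda>j. avg_norm q I (\<lambda>i. F i j)) powr p) powr (1 / p)"
    by (rule powr_mono2[rotated 2]) (use assms in auto)
  then show ?thesis using assms by (simp add: powr_powr avg_norm_nonneg)
qed

text \<open>The operator \<open>\<Otimes>\<^sub>i (r \<cdot> id + (1 - r) \<cdot> mean)\<close>, written with its kernel because the kernel is
  nonnegative for \<open>0 \<le> r \<le> 1\<close>; the recursion over coordinates then lives on arbitrary finite index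
  sets.\<close>

definition noise :: "'i set \<Rightarrow> real \<Rightarrow> (('i \<Rightarrow> real) \<Rightarrow> 'a::real_vector) \<Rightarrow> ('i \<Rightarrow> real) \<Rightarrow> 'a"
  where "noise J r u \<epsilon> = (\<Sum>\<delta>\<in>J \<rightarrow>\<^sub>E {-1, 1}. (\<Prod>i\<in>J. (1 + r * \<epsilon> i * \<delta> i) / 2) *\<^sub>R u \<delta>)"

lemma bij_betw_insert_coordinate:
  assumes "j \<notin> J"
  shows "bij_betw (\<lambda>(s, g). g(j := s)) ({-1, 1} \<times> (J \<rightarrow>\<^sub>E {-1, 1})) (insert j J \<rightarrow>\<^sub>E {-1, 1 :: real})"
  using inj_combinator[OF assms, of "\<lambda>_. {-1, 1 :: real}"] PiE_insert_eq[of j J "\<lambda>_. {-1, 1 :: real}"]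
  by (simp add: bij_betw_def)

lemma noise_insert:
  assumes J: "finite J" "j \<notin> J" 
  shows "noise (insert j J) r u (g(j := s))
    = noise J r (\<lambda>g'. ((1 - r * s) / 2) *\<^sub>R u (g'(j := -1)) + ((1 + r * s) / 2) *\<^sub>R u (g'(j := 1))) g"
proof -
  let ?E = "J \<rightarrow>\<^sub>E {-1, 1 :: real}"
  let ?w = "\<lambda>\<delta>. \<Prod>i\<in>J. (1 + r * g i * \<delta> i) / 2"
  have prod: "(\<Prod>i\<in>insert j J. (1 + r * (g(j := s)) i * (\<delta>(j := t)) i) / 2) = (1 + r * s * t) / 2 * ?w \<delta>" for \<delta> t
  proof -
    have "(\<Prod>i\<in>J. (1 + r * (g(j := s)) i * (\<delta>(j := t)) i) / 2) = ?w \<delta>"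
      using J by (intro prod.cong) auto
    then show ?thesis using J by simp
  qed
  have "noise (insert j J) r u (g(j := s))
      = (\<Sum>(t, \<delta>)\<in>{-1, 1} \<times> ?E. ((1 + r * s * t) / 2 * ?w \<delta>) *\<^sub>R u (\<delta>(j := t)))"
    unfolding noise_def sum.reindex_bij_betw[OF bij_betw_insert_coordinate[OF J(2)], symmetric]
    by (intro sum.cong refl) (auto simp only: prod prod.case split: prod.splits)
  also have "\<dots> = (\<Sum>t\<in>{-1, 1}. \<Sum>\<delta>\<in>?E. ((1 + r * s * t) / 2 * ?w \<delta>) *\<^sub>R u (\<delta>(j := t)))"
    by (rule sum.cartesian_product[symmetric])
  also have "\<dots> = (\<Sum>\<delta>\<in>?E. \<Sum>t\<in>{-1, 1}. ((1 + r * s * t) / 2 * ?w \<delta>) *\<^sub>R u (\<delta>(j := t)))"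
    by (rule sum.swap)
  also have "\<dots> = noise J r (\<lambda>g'. ((1 - r * s) / 2) *\<^sub>R u (g'(j := -1)) + ((1 + r * s) / 2) *\<^sub>R u (g'(j := 1))) g"
    unfolding noise_def by (intro sum.cong refl) (simp add: scaleR_add_right mult.commute)
  finally show ?thesis .
qed

lemma avg_norm_insert_coordinate:
  assumes "p > 0" "j \<notin> J"
  shows "avg_norm p (insert j J \<rightarrow>\<^sub>E {-1, 1 :: real}) F
    = avg_norm p {-1, 1} (\<lambda>s. avg_norm p (J \<rightarrow>\<^sub>E {-1, 1}) (\<lambda>g. F (g(j := s))))"
  unfolding avg_norm_Times[OF assms(1), symmetric]
  using avg_norm_reindex[OF bij_betw_insert_coordinate[OF assms(2)], of p F]
  by (simp add: case_prod_unfold)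

text \<open>Tensorization. Split off one coordinate \<open>j\<close>; the induction hypothesis handles the other
  coordinates, Minkowski's inequality moves the \<open>L\<^sub>q\<close> norm in \<open>j\<close> inside the \<open>L\<^sub>p\<close> norm, and
  the two-point inequality replaces it by the \<open>L\<^sub>p\<close> norm.\<close>

lemma noise_hypercontractive:
  fixes u :: "('i \<Rightarrow> real) \<Rightarrow> real"
  assumes "1 < p" "p \<le> q" and r: "0 \<le> r" "r \<le> 1"
    and two: "\<And>u v. 0 \<le> u \<Longrightarrow> 0 \<le> v \<Longrightarrow>
      ((((1 + r) / 2 * u + (1 - r) / 2 * v) powr q + ((1 - r) / 2 * u + (1 + r) / 2 * v) powr q) / 2)
        \<le> ((u powr p + v powr p) / 2) powr (q / p)"
    and J: "finite J" and u: "\<And>\<epsilon>. 0 \<le> u \<epsilon>"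
  shows "avg_norm q (J \<rightarrow>\<^sub>E {-1, 1}) (noise J r u) \<le> avg_norm p (J \<rightarrow>\<^sub>E {-1, 1}) u"
  using J u
proof (induction J arbitrary: u rule: finite_induct)
  case empty
  then show ?case using assms(1,2) by (simp add: noise_def avg_norm_def powr_powr)
next
  case (insert j J u)
  let ?E = "J \<rightarrow>\<^sub>E {-1, 1 :: real}"
  have finE: "finite ?E" using insert.hyps by (intro finite_PiE) auto
  define v where "v = (\<lambda>s g. (1 - r * s) / 2 * u (g(j := -1)) + (1 + r * s) / 2 * u (g(j := 1)))"
  have v0: "0 \<le> v s g" if "s \<in> {-1, 1}" for s g
    using that r insert.prems by (auto simp: v_def)
  have "avg_norm q (insert j J \<rightarrow>\<^sub>E {-1, 1}) (noise (insert j J) r u)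
      = avg_norm q {-1, 1} (\<lambda>s. avg_norm q ?E (noise J r (v s)))"
    using assms insert.hyps
    by (simp add: avg_norm_insert_coordinate noise_insert v_def)
  also have "\<dots> \<le> avg_norm q {-1, 1} (\<lambda>s. avg_norm p ?E (v s))"
  proof (rule avg_norm_mono)
    fix s :: real assume "s \<in> {-1, 1}"
    (* The truncation only serves to make the function nonnegative for every g. *)
    then have "avg_norm q ?E (noise J r (\<lambda>g. max 0 (v s g))) \<le> avg_norm p ?E (\<lambda>g. max 0 (v s g))"
      by (intro insert.IH) auto
    moreover have "(\<lambda>g. max 0 (v s g)) = v s"
      using v0[OF \<open>s \<in> {-1, 1}\<close>] by (auto simp: max_def fun_eq_iff)
    ultimately show "norm (avg_norm q ?E (noise J r (v s))) \<le> norm (avg_norm p ?E (v s))"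
      by (simp add: avg_norm_nonneg)
  qed (use assms in auto)
  also have "\<dots> \<le> avg_norm p ?E (\<lambda>g. avg_norm q {-1, 1} (\<lambda>s. v s g))"
    using assms finE by (intro avg_norm_Minkowski) auto
  also have "\<dots> \<le> avg_norm p ?E (\<lambda>g. avg_norm p {-1, 1} (\<lambda>s. u (g(j := s))))"
  proof (rule avg_norm_mono)
    fix g
    let ?a = "u (g(j := -1))" and ?b = "u (g(j := 1))"
    have "avg_norm q {-1, 1} (\<lambda>s. v s g) = ((v (-1) g powr q + v 1 g powr q) / 2) powr (1 / q)"
      using v0 by (simp add: avg_norm_def)
    also have "\<dots> = ((((1 + r) / 2 * ?a + (1 - r) / 2 * ?b) powr q + ((1 - r) / 2 * ?a + (1 + r) / 2 * ?b) powr q) / 2) powr (1 / q)"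
      by (simp add: v_def)
    also have "\<dots> \<le> (((?a powr p + ?b powr p) / 2) powr (q / p)) powr (1 / q)"
      using assms insert.prems by (intro powr_mono2 two) auto
    also have "\<dots> = ((?a powr p + ?b powr p) / 2) powr (1 / p)"
      using assms by (simp add: powr_powr)
    also have "\<dots> = avg_norm p {-1, 1} (\<lambda>s. u (g(j := s)))"
      using insert.prems by (simp add: avg_norm_def)
    finally show "norm (avg_norm q {-1, 1} (\<lambda>s. v s g)) \<le> norm (avg_norm p {-1, 1} (\<lambda>s. u (g(j := s))))"
      by (simp add: avg_norm_nonneg)
  qed (use assms in auto)
  also have "\<dots> = avg_norm p (insert j J \<rightarrow>\<^sub>E {-1, 1}) u"
    using assms insert.hyps 
    by (simp add: avg_norm_insert_coordinate avg_norm_Times_swap[of p ?E "{-1, 1}"])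
  finally show ?case .
qed

lemma multiplier_power_eq_noise:
  fixes f :: "(nat \<Rightarrow> real) \<Rightarrow> 'a::complex_normed_vector"
  shows "multiplier n (\<lambda>A. of_real r ^ card A) f \<epsilon> = noise {1..n} r f \<epsilon>"
proof -
  have kernel: "(\<Prod>i\<in>{1..n}. (1 + r * \<epsilon> i * \<delta> i) / 2) = (\<Sum>A\<in>Pow {1..n}. walsh A \<epsilon> * r ^ card A * walsh A \<delta> / 2 ^ n)" for \<delta>
  proof -
    have "(\<Prod>i\<in>{1..n}. (1 + r * \<epsilon> i * \<delta> i) / 2) = (\<Prod>i\<in>{1..n}. r * \<epsilon> i * \<delta> i + 1) / 2 ^ n"
      by (simp add: prod_dividef add.commute)
    also have "(\<Prod>i\<in>{1..n}. r * \<epsilon> i * \<delta> i + 1) = (\<Sum>A\<in>Pow {1..n}. walsh A \<epsilon> * r ^ card A * walsh A \<delta>)"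
      by (simp add: prod_add walsh_def prod.distrib mult_ac)
    finally show ?thesis by (simp add: sum_divide_distrib)
  qed
  have "multiplier n (\<lambda>A. of_real r ^ card A) f \<epsilon>
      = (\<Sum>A\<in>Pow {1..n}. (walsh A \<epsilon> * r ^ card A) *\<^sub>R fourier_coeff n f A)"
    by (simp add: multiplier_def scaleR_scaleC scaleC_scaleC)
  also have "\<dots> = (\<Sum>A\<in>Pow {1..n}. \<Sum>\<delta>\<in>hcube n. (walsh A \<epsilon> * r ^ card A * walsh A \<delta> / 2 ^ n) *\<^sub>R f \<delta>)"
    by (simp add: fourier_coeff_def scaleR_sum_right mult_ac)
  also have "\<dots> = (\<Sum>\<delta>\<in>hcube n. (\<Prod>i\<in>{1..n}. (1 + r * \<epsilon> i * \<delta> i) / 2) *\<^sub>R f \<delta>)"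
    unfolding kernel by (subst sum.swap) (simp add: scaleR_sum_left)
  finally show ?thesis by (simp add: noise_def hcube_def)
qed

text \<open>The kernel is nonnegative, so the norm of the image of \<open>f\<close> is at most the image of the scalar
  function \<open>norm \<circ> f\<close>, and the scalar inequality carries over to vector values.\<close>

lemma multiplier_hypercontractive:
  assumes "1 < p" "p \<le> q"
  obtains r :: real where "0 < r"
    "\<And>n (f :: (nat \<Rightarrow> real) \<Rightarrow> 'a::complex_normed_vector).
      avg_norm q (hcube n) (multiplier n (\<lambda>A. of_real r ^ card A) f) \<le> avg_norm p (hcube n) f"
proof -
  obtain r where r: "0 < r" "r \<le> 1 / 2" and two: "\<And>u v. 0 \<le> u \<Longrightarrow> 0 \<le> v \<Longrightarrow>
      ((((1 + r) / 2 * u + (1 - r) / 2 * v) powr q + ((1 - r) / 2 * u + (1 + r) / 2 * v) powr q) / 2)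
        \<le> ((u powr p + v powr p) / 2) powr (q / p)"
    using two_point_hypercontractive[OF assms] by blast
  have "avg_norm q (hcube n) (multiplier n (\<lambda>A. of_real r ^ card A) f) \<le> avg_norm p (hcube n) f"
    for n and f :: "(nat \<Rightarrow> real) \<Rightarrow> 'a"
  proof -
    have "avg_norm q (hcube n) (multiplier n (\<lambda>A. of_real r ^ card A) f) \<le> avg_norm q (hcube n) (noise {1..n} r (\<lambda>\<delta>. norm (f \<delta>)))"
    proof (rule avg_norm_mono)
      fix \<epsilon> assume \<epsilon>: "\<epsilon> \<in> hcube n"
      have pos: "0 \<le> (\<Prod>i\<in>{1..n}. (1 + r * \<epsilon> i * \<delta> i) / 2)" if "\<delta> \<in> hcube n" for \<delta>
      proof (rule prod_nonneg)
        fix i assume i: "i \<in> {1..n}"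
        have "\<epsilon> i \<in> {-1, 1}" "\<delta> i \<in> {-1, 1}" using \<epsilon> that i unfolding hcube_def by (auto simp only: PiE_mem)
        then show "0 \<le> (1 + r * \<epsilon> i * \<delta> i) / 2" using r by auto
      qed
      have "norm (noise {1..n} r f \<epsilon>) \<le> (\<Sum>\<delta>\<in>hcube n. (\<Prod>i\<in>{1..n}. (1 + r * \<epsilon> i * \<delta> i) / 2) *\<^sub>R norm (f \<delta>))"
        unfolding noise_def hcube_def[symmetric]
        by (rule sum_norm_le) (simp add: abs_of_nonneg pos del: One_nat_def)
      also have "\<dots> = noise {1..n} r (\<lambda>\<delta>. norm (f \<delta>)) \<epsilon>" by (simp add: noise_def hcube_def)
      finally show "norm (multiplier n (\<lambda>A. of_real r ^ card A) f \<epsilon>) \<le> norm (noise {1..n} r (\<lambda>\<delta>. norm (f \<delta>)) \<epsilon>)"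
        unfolding multiplier_power_eq_noise by simp
    qed (use assms in auto)
    also have "\<dots> \<le> avg_norm p (hcube n) (\<lambda>\<delta>. norm (f \<delta>))"
      unfolding hcube_def using assms r two by (intro noise_hypercontractive) auto
    also have "\<dots> = avg_norm p (hcube n) f" by (intro avg_norm_cong) simp
    finally show ?thesis .
  qed
  with r show ?thesis by (intro that) auto
qed

lemma Rad_eq_multiplier:
  fixes f :: "(nat \<Rightarrow> real) \<Rightarrow> 'a::complex_normed_vector"
  shows "Rad n f = multiplier n (level 1) f"
proof
  fix \<epsilon>
  have "multiplier n (level 1) f \<epsilon> = (\<Sum>A\<in>(\<lambda>i. {i}) ` {1..n}. walsh A \<epsilon> *\<^sub>R (level 1 A *\<^sub>C fourier_coeff n f A))"
    unfolding multiplier_def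
    by (rule sum.mono_neutral_right) (auto simp: level_def card_1_singleton_iff)
  also have "\<dots> = Rad n f \<epsilon>"
    by (subst sum.reindex) (auto simp: level_def Rad_def walsh_def scaleC_one)
  finally show "Rad n f \<epsilon> = multiplier n (level 1) f \<epsilon>" by simp
qed

lemma fourier_coeff_scaleR:
  "fourier_coeff n (\<lambda>\<epsilon>. c *\<^sub>R f \<epsilon>) A = c *\<^sub>R fourier_coeff n f A"
  by (simp add: fourier_coeff_def scaleR_sum_right mult_ac)

text \<open>K-convexity speaks of a supremum over the unit ball in \<open>ennreal\<close>; homogeneity turns its finiteness
  into one operator bound valid in all dimensions.\<close>

lemma K_convex_multiplier_bound:
  fixes T :: "'a::complex_normed_vector itself"
  assumes "K_convex T"
  obtains p K where "p > 1" "K \<ge> 0" "\<And>n. n \<ge> 1 \<Longrightarrow> multiplier_bound T n p (level 1) K"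
proof -
  obtain p where p: "p > 1" and fin: "(SUP n\<in>{1..}. Rad_opnorm T n p) < \<infinity>"
    using assms unfolding K_convex_def by blast
  define K where "K = enn2real (SUP n\<in>{1..}. Rad_opnorm T n p)"
  have K: "ennreal K = (SUP n\<in>{1..}. Rad_opnorm T n p)" using fin by (simp add: K_def)
  have "multiplier_bound T n p (level 1) K" if n: "n \<ge> 1" for n
    unfolding multiplier_bound_def
  proof
    fix f :: "(nat \<Rightarrow> real) \<Rightarrow> 'a"
    let ?N = "avg_norm p (hcube n)"
    have unit: "?N (multiplier n (level 1) g) \<le> K" if "?N g \<le> 1" for g :: "(nat \<Rightarrow> real) \<Rightarrow> 'a"
    proof -
      have "ennreal (Lp_norm n p (Rad n g)) \<le> Rad_opnorm T n p"
        unfolding Rad_opnorm_def using that by (intro SUP_upper) (auto simp: Lp_norm_eq_avg_norm)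
      also have "\<dots> \<le> (SUP n\<in>{1..}. Rad_opnorm T n p)" using n by (intro SUP_upper) auto
      finally have "ennreal (Lp_norm n p (Rad n g)) \<le> ennreal K" unfolding K .
      then show ?thesis by (simp add: K_def Lp_norm_eq_avg_norm Rad_eq_multiplier)
    qed
    show "?N (multiplier n (level 1) f) \<le> K * ?N f"
    proof (cases "?N f = 0")
      case True
      then have "f \<epsilon> = 0" if "\<epsilon> \<in> hcube n" for \<epsilon> using avg_norm_eq_0D[OF True _ _ that] p by simp
      then have "fourier_coeff n f A = 0" for A by (simp add: fourier_coeff_def)
      then have "multiplier n (level 1) f = (\<lambda>_. 0)" by (simp add: multiplier_def fun_eq_iff)
      then show ?thesis using True by (simp add: avg_norm_zero)
    next
      case False
      define s where "s = ?N f"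
      have s: "s > 0" using False avg_norm_nonneg[of p "hcube n" f] by (simp add: s_def)
      let ?g = "\<lambda>\<epsilon>. (1 / s) *\<^sub>R f \<epsilon>"
      have "?N ?g = 1 / s * ?N f" using p s by (intro avg_norm_scale) auto
      then have "?N (multiplier n (level 1) ?g) \<le> K" using s by (intro unit) (simp add: s_def)
      moreover have "?N (multiplier n (level 1) ?g) = 1 / s * ?N (multiplier n (level 1) f)"
      proof (rule avg_norm_scale)
        fix \<epsilon>
        have "multiplier n (level 1) ?g \<epsilon> = (1 / s) *\<^sub>R multiplier n (level 1) f \<epsilon>"
          by (simp add: multiplier_def fourier_coeff_scaleR scaleR_sum_right scaleR_scaleC_commute[symmetric] mult_ac)
        then show "norm (multiplier n (level 1) ?g \<epsilon>) = 1 / s * norm (multiplier n (level 1) f \<epsilon>)"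
          using s by simp
      qed (use p s in auto)
      ultimately have "1 / s * ?N (multiplier n (level 1) f) \<le> K" by simp
      then show ?thesis using s by (simp add: s_def[symmetric] divide_le_eq)
    qed
  qed
  then show ?thesis using that[OF p, of K] by (simp add: K_def)
qed

text \<open>On the image of \<open>level 1\<close> the noise operator is multiplication by \<open>r\<close>. Applied before the projection
  (if \<open>p \<le> p0\<close>) or after it (if \<open>p > p0\<close>), it changes the exponent by hypercontractivity, at the
  price of the factor \<open>1 / r\<close>.\<close>

lemma multiplier_bound_level_1_all_exponents:
  fixes T :: "'a::complex_normed_vector itself"
  assumes "K_convex T" and p: "p > 1"
  obtains K where "K \<ge> 0" "\<And>n. n \<ge> 1 \<Longrightarrow> multiplier_bound T n p (level 1) K"
proof -
  obtain p0 K where p0: "p0 > 1" and K: "K \<ge> 0" "\<And>n. n \<ge> 1 \<Longrightarrow> multiplier_bound T n p0 (level 1) K"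
    using K_convex_multiplier_bound[OF assms(1)] by metis
  obtain r where r: "0 < r" and hyp: "\<And>n (f :: (nat \<Rightarrow> real) \<Rightarrow> 'a).
      avg_norm (max p p0) (hcube n) (multiplier n (\<lambda>A. of_real r ^ card A) f) \<le> avg_norm (min p p0) (hcube n) f"
  proof (rule multiplier_hypercontractive[of "min p p0" "max p p0", where ?'a = 'a])
  qed (use p p0 in auto)
  have "multiplier_bound T n p (level 1) (K / r)" if n: "n \<ge> 1" for n
  proof (rule multiplier_bound_unscale)
    show "multiplier_bound T n p (\<lambda>A. of_real r * level 1 A) K"
      unfolding multiplier_bound_def
    proof
      fix f :: "(nat \<Rightarrow> real) \<Rightarrow> 'a"
      let ?N = "\<lambda>p. avg_norm p (hcube n)" and ?T = "multiplier n (\<lambda>A. of_real r ^ card A)"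
      let ?R = "multiplier n (level 1)"
      have K0: "?N p0 (?R g) \<le> K * ?N p0 g" for g :: "(nat \<Rightarrow> real) \<Rightarrow> 'a"
        using K(2)[OF n] by (simp add: multiplier_bound_def)
      have eq1: "multiplier n (\<lambda>A. of_real r * level 1 A) f = ?R (?T f)"
        and eq2: "multiplier n (\<lambda>A. of_real r * level 1 A) f = ?T (?R f)"
        unfolding multiplier_multiplier by (auto simp: level_def split: if_splits intro!: multiplier_cong)
      show "?N p (multiplier n (\<lambda>A. of_real r * level 1 A) f) \<le> K * ?N p f"
      proof (cases "p \<le> p0")
        case True
        have "?N p (?R (?T f)) \<le> ?N p0 (?R (?T f))" using True p by (intro avg_norm_mono_exponent) auto
        also have "\<dots> \<le> K * ?N p0 (?T f)" by (rule K0)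
        also have "\<dots> \<le> K * ?N p f" using hyp[of n f] True K by (intro mult_left_mono) (auto simp: max_def min_def split: if_splits)
        finally show ?thesis unfolding eq1 .
      next
        case False
        have "?N p (?T (?R f)) \<le> ?N p0 (?R f)" using hyp[of n "?R f"] False by (simp add: max_def min_def)
        also have "\<dots> \<le> K * ?N p0 f" by (rule K0)
        also have "\<dots> \<le> K * ?N p f" using False p0 K by (intro mult_left_mono avg_norm_mono_exponent) auto
        finally show ?thesis unfolding eq2 .
      qed
    qed
  qed (use p r in auto)
  then show ?thesis using K(1) r by (intro that[of "K / r"]) auto
qed

section \<open>A vector-valued maximum principle and extrapolation past a corner\<close>

text \<open>Summing over the fourth roots of unity kills the first and second order Taylor terms. The resulting
  error \<open>O(h ^ 3)\<close> is smaller than the \<open>h\<^sup>2\<close> gained from a quadratic perturbation in the next proof.\<close>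

lemma four_point_mean:
  fixes f :: "complex \<Rightarrow> complex"
  assumes "f holomorphic_on U" "open U" "z \<in> U"
  shows "\<exists>R>0. \<exists>B\<ge>0. \<forall>h::real. 0 < h \<and> h \<le> R \<longrightarrow>
    cmod (f z - (\<Sum>w\<in>{1, -1, \<i>, -\<i>}. f (z + of_real h * w)) / 4) \<le> B * h ^ 3"
proof -
  obtain R where R: "R > 0" "cball z R \<subseteq> U" using assms open_contains_cball by blast
  let ?D = "\<lambda>i. (deriv ^^ i) f"
  have hol: "?D i holomorphic_on U" for i using assms by (intro holomorphic_higher_deriv)
  have "compact (?D 3 ` cball z R)"
    using hol R by (intro compact_continuous_image compact_cball) (meson holomorphic_on_imp_continuous_on continuous_on_subset)
  then obtain B where B: "\<And>x. x \<in> cball z R \<Longrightarrow> cmod (?D 3 x) \<le> B"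
    using compact_imp_bounded bounded_iff by (metis image_eqI)
  have B0: "B \<ge> 0" using B[of z] R norm_ge_zero order_trans by (metis centre_in_cball less_imp_le)
  have taylor: "cmod (f w - (\<Sum>i\<le>2. ?D i z * (w - z) ^ i / fact i)) \<le> B * cmod (w - z) ^ Suc 2 / fact 2"
    if "w \<in> cball z R" for w
  proof -
    have "cmod (?D 0 w - (\<Sum>i\<le>2. ?D i z * (w - z) ^ i / fact i)) \<le> B * cmod (w - z) ^ Suc 2 / fact 2"
    proof (rule complex_Taylor[where S = "cball z R"])
      fix i x assume x: "x \<in> cball z R"
      have "(?D i has_field_derivative deriv (?D i) x) (at x)"
        using hol[of i] assms x R by (auto intro: holomorphic_derivI)
      then show "(?D i has_field_derivative ?D (Suc i) x) (at x within cball z R)"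
        by (simp add: has_field_derivative_at_within)
    qed (use B R that in \<open>auto simp: numeral_3_eq_3 numeral_2_eq_2\<close>)
    then show ?thesis by simp
  qed
  have "cmod (f z - (\<Sum>w\<in>{1, -1, \<i>, -\<i>}. f (z + of_real h * w)) / 4) \<le> B * h ^ 3"
    if h: "0 < h" "h \<le> R" for h :: real
  proof -
    let ?W = "{1, -1, \<i>, -\<i>}"
    let ?P = "\<lambda>w. \<Sum>i\<le>2. ?D i z * (of_real h * w) ^ i / fact i"
    have ne: "1 \<noteq> \<i>" "\<i> \<noteq> 1" "-1 \<noteq> \<i>" "1 \<noteq> -\<i>" "\<i> \<noteq> -1" "\<i> \<noteq> -\<i>" by (auto simp: complex_eq_iff)
    have card: "card ?W = 4" using ne by simp
    have P: "(\<Sum>w\<in>?W. ?P w) = 4 * f z"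
      using ne by (simp add: numeral_2_eq_2 power_mult_distrib) (simp add: power2_eq_square algebra_simps)?
    have "f z - (\<Sum>w\<in>?W. f (z + of_real h * w)) / 4 = - (\<Sum>w\<in>?W. f (z + of_real h * w) - ?P w) / 4"
      unfolding sum_subtractf P by simp
    then have "cmod (f z - (\<Sum>w\<in>?W. f (z + of_real h * w)) / 4) = cmod (\<Sum>w\<in>?W. f (z + of_real h * w) - ?P w) / 4"
      by (simp add: norm_divide)
    also have "\<dots> \<le> (\<Sum>w\<in>?W. B * h ^ 3) / 4"
    proof (intro divide_right_mono sum_norm_le)
      fix w assume w: "w \<in> ?W"
      then have nw: "cmod (of_real h * w) = h" using h by (auto simp: norm_mult)
      have "cmod (f (z + of_real h * w) - ?P w) \<le> B * h ^ Suc 2 / fact 2"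
        using taylor[of "z + of_real h * w"] nw h by (simp add: dist_norm)
      also have "\<dots> \<le> B * h ^ 3" using B0 h by (simp add: numeral_3_eq_3 numeral_2_eq_2)
      finally show "cmod (f (z + of_real h * w) - ?P w) \<le> B * h ^ 3" .
    qed simp
    also have "\<dots> = B * h ^ 3" by (subst sum_constant) (simp add: card)
    finally show ?thesis .
  qed
  with R B0 show ?thesis by blast
qed

text \<open>The maximum principle for a vector-valued analytic function, whose values are given by their
  coefficients \<open>\<phi> z\<close> in a finite family and measured by the seminorm \<open>\<nu>\<close>. If the claim failed, \<open>\<nu> (\<phi> z) + \<eta> * (cmod z)\<^sup>2\<close> would for
  small \<open>\<eta>\<close> have a maximum at an interior point; but the mean over four points at distance \<open>h\<close> exceeds the
  value at the centre by at least \<open>\<eta> * h\<^sup>2 - O(h ^ 3)\<close>.\<close>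

lemma seminorm_maximum_principle:
  fixes \<phi> :: "complex \<Rightarrow> 'k \<Rightarrow> complex" and \<nu> :: "('k \<Rightarrow> complex) \<Rightarrow> real"
  assumes I: "finite I"
    and tri: "\<And>c c'. \<nu> (\<lambda>k. c k + c' k) \<le> \<nu> c + \<nu> c'"
    and scale: "\<And>a c. \<nu> (\<lambda>k. a * c k) = cmod a * \<nu> c"
    and bound: "\<And>c. \<nu> c \<le> L * (\<Sum>k\<in>I. cmod (c k))" and L: "L \<ge> 0"
    and S: "compact S" and U: "open U" "U \<subseteq> S"
    and hol: "\<And>k. k \<in> I \<Longrightarrow> (\<lambda>z. \<phi> z k) holomorphic_on U"
    and cont: "\<And>k. k \<in> I \<Longrightarrow> continuous_on S (\<lambda>z. \<phi> z k)"
    and frontier: "\<And>z. z \<in> S - U \<Longrightarrow> \<nu> (\<phi> z) \<le> B"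
    and z: "z \<in> S"
  shows "\<nu> (\<phi> z) \<le> B"
proof (rule ccontr)
  assume "\<not> \<nu> (\<phi> z) \<le> B"
  then have gap: "\<nu> (\<phi> z) > B" by simp
  have diff: "\<nu> c - \<nu> c' \<le> L * (\<Sum>k\<in>I. cmod (c k - c' k))" for c c'
    using tri[of "\<lambda>k. c k - c' k" c'] bound[of "\<lambda>k. c k - c' k"] by simp
  have lip: "\<bar>\<nu> c - \<nu> c'\<bar> \<le> L * (\<Sum>k\<in>I. cmod (c k - c' k))" for c c'
    using diff[of c c'] diff[of c' c] by (simp add: abs_le_iff norm_minus_commute)
  have contN: "continuous_on S (\<lambda>z. \<nu> (\<phi> z))"
    unfolding continuous_on_def
  proof
    fix x assume x: "x \<in> S"
    have "((\<lambda>z. L * (\<Sum>k\<in>I. cmod (\<phi> z k - \<phi> x k))) \<longlongrightarrow> L * (\<Sum>k\<in>I. cmod (\<phi> x k - \<phi> x k))) (at x within S)"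
      using cont x by (intro tendsto_intros) (auto simp: continuous_on_def)
    then have "((\<lambda>z. L * (\<Sum>k\<in>I. cmod (\<phi> z k - \<phi> x k))) \<longlongrightarrow> 0) (at x within S)" by simp
    then have "((\<lambda>z. \<nu> (\<phi> z) - \<nu> (\<phi> x)) \<longlongrightarrow> 0) (at x within S)"
      by (rule tendsto_rabs_zero_cancel[OF tendsto_sandwich[OF _ _ tendsto_const, rotated 2]])
        (auto simp: lip)
    then show "((\<lambda>z. \<nu> (\<phi> z)) \<longlongrightarrow> \<nu> (\<phi> x)) (at x within S)" by (simp add: LIM_zero_iff)
  qed
  obtain M where M: "M > 0" "\<And>x. x \<in> S \<Longrightarrow> cmod x \<le> M"
    using compact_imp_bounded[OF S] bounded_pos[of S] by auto
  (* At most half of the gap can be lost to the perturbation, so the maximum stays interior. *)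
  define \<eta> where "\<eta> = (\<nu> (\<phi> z) - B) / (2 * M ^ 2)"
  have \<eta>: "\<eta> > 0" using gap M by (simp add: \<eta>_def)
  let ?N = "\<lambda>x. \<nu> (\<phi> x) + \<eta> * (cmod x) ^ 2"
  obtain x where x: "x \<in> S" and max: "\<And>y. y \<in> S \<Longrightarrow> ?N y \<le> ?N x"
  proof -
    have "continuous_on S ?N" by (intro continuous_intros contN)
    moreover have "S \<noteq> {}" using z by blast
    ultimately show ?thesis using continuous_attains_sup[OF S, of ?N] that by blast
  qed
  have "x \<in> U"
  proof (rule ccontr)
    assume "x \<notin> U"
    then have "\<nu> (\<phi> x) \<le> B" using x frontier by blast
    moreover have "\<eta> * (cmod x) ^ 2 \<le> \<eta> * M ^ 2" using M x \<eta> by (intro mult_left_mono power_mono) auto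
    moreover have "\<eta> * M ^ 2 = (\<nu> (\<phi> z) - B) / 2" using M by (simp add: \<eta>_def)
    moreover have "\<nu> (\<phi> z) \<le> ?N z" using \<eta> by simp
    ultimately show False using max[OF z] gap by (simp add: field_simps)
  qed
  obtain R1 where R1: "R1 > 0" "cball x R1 \<subseteq> U" using U \<open>x \<in> U\<close> open_contains_cball by blast
  have "\<forall>k\<in>I. \<exists>R>0. \<exists>B\<ge>0. \<forall>h::real. 0 < h \<and> h \<le> R \<longrightarrow>
    cmod (\<phi> x k - (\<Sum>w\<in>{1, -1, \<i>, -\<i>}. \<phi> (x + of_real h * w) k) / 4) \<le> B * h ^ 3"
    using four_point_mean[OF hol U(1) \<open>x \<in> U\<close>] by blast
  then obtain R C where RC: "\<And>k. k \<in> I \<Longrightarrow> R k > 0" "\<And>k. k \<in> I \<Longrightarrow> C k \<ge> 0"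
    "\<And>k h. k \<in> I \<Longrightarrow> 0 < h \<Longrightarrow> h \<le> R k \<Longrightarrow>
      cmod (\<phi> x k - (\<Sum>w\<in>{1, -1, \<i>, -\<i>}. \<phi> (x + of_real h * w) k) / 4) \<le> C k * h ^ 3" by metis
  define K where "K = L * (\<Sum>k\<in>I. C k)"
  have K: "K \<ge> 0" using L RC by (simp add: K_def sum_nonneg)
  define V where "V = insert R1 (insert (\<eta> / (2 * (K + 1))) (R ` I))"
  define h where "h = Min V"
  have V: "finite V" "\<And>v. v \<in> V \<Longrightarrow> v > 0" using I R1 RC \<eta> K by (auto simp: V_def)
  have "h \<le> v" if "v \<in> V" for v unfolding h_def using V that by (intro Min_le) auto
  moreover have "h \<in> V" unfolding h_def using V by (intro Min_in) (auto simp: V_def)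
  ultimately have h: "h > 0" "h \<le> R1" "h \<le> \<eta> / (2 * (K + 1))" "\<And>k. k \<in> I \<Longrightarrow> h \<le> R k"
    using V by (auto simp: V_def)
  let ?W = "{1, -1, \<i>, -\<i>}"
  have ne: "1 \<noteq> \<i>" "\<i> \<noteq> 1" "-1 \<noteq> \<i>" "1 \<noteq> -\<i>" "\<i> \<noteq> -1" "\<i> \<noteq> -\<i>" by (auto simp: complex_eq_iff)
  let ?p = "\<lambda>w. x + of_real h * w"
  have inS: "?p w \<in> S" if "w \<in> ?W" for w
  proof -
    have "cmod (of_real h * w) = h" using that h by (auto simp: norm_mult)
    then have "?p w \<in> cball x R1" using h by (simp add: dist_norm)
    then show ?thesis using R1 U by blast
  qed
  let ?avg = "\<lambda>k. (\<Sum>w\<in>?W. \<phi> (?p w) k) / 4"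
  have "\<nu> (\<phi> x) - \<nu> ?avg \<le> L * (\<Sum>k\<in>I. cmod (\<phi> x k - ?avg k))" by (rule diff)
  also have "\<dots> \<le> L * (\<Sum>k\<in>I. C k * h ^ 3)"
    using L RC h by (intro mult_left_mono sum_mono) auto
  also have "\<dots> = K * h ^ 3" by (simp add: K_def sum_distrib_right)
  finally have 1: "\<nu> (\<phi> x) \<le> \<nu> ?avg + K * h ^ 3" by simp
  have "\<nu> ?avg = \<nu> (\<lambda>k. (1 / 4) * (\<phi> (?p 1) k + (\<phi> (?p (-1)) k + (\<phi> (?p \<i>) k + \<phi> (?p (-\<i>)) k))))"
    using ne by (simp add: add.assoc)
  also have "\<dots> = 1 / 4 * \<nu> (\<lambda>k. \<phi> (?p 1) k + (\<phi> (?p (-1)) k + (\<phi> (?p \<i>) k + \<phi> (?p (-\<i>)) k)))"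
    by (subst scale) (simp add: norm_divide)
  also have "\<dots> \<le> 1 / 4 * (\<nu> (\<phi> (?p 1)) + (\<nu> (\<phi> (?p (-1))) + (\<nu> (\<phi> (?p \<i>)) + \<nu> (\<phi> (?p (-\<i>))))))"
    by (intro mult_left_mono order_trans[OF tri] add_mono order_refl) auto
  finally have 2: "\<nu> ?avg \<le> (\<nu> (\<phi> (?p 1)) + \<nu> (\<phi> (?p (-1))) + \<nu> (\<phi> (?p \<i>)) + \<nu> (\<phi> (?p (-\<i>)))) / 4" by simp
  have sq: "(cmod (?p 1))\<^sup>2 + (cmod (?p (-1)))\<^sup>2 + (cmod (?p \<i>))\<^sup>2 + (cmod (?p (-\<i>)))\<^sup>2 = 4 * (cmod x)\<^sup>2 + 4 * h\<^sup>2"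
    by (simp add: cmod_power2) (simp add: power2_eq_square algebra_simps)
  have 3: "?N (?p 1) + ?N (?p (-1)) + ?N (?p \<i>) + ?N (?p (-\<i>)) \<le> 4 * ?N x"
    using max[OF inS[of 1]] max[OF inS[of "-1"]] max[OF inS[of \<i>]] max[OF inS[of "-\<i>"]] by simp
  have "4 * \<nu> ?avg + \<eta> * (4 * (cmod x)\<^sup>2 + 4 * h\<^sup>2) \<le> 4 * ?N x"
    using 2 3 unfolding sq[symmetric] by (simp add: distrib_left)
  then have "\<eta> * h ^ 2 \<le> K * h ^ 3" using 1 by (simp add: distrib_left)
  then have "\<eta> \<le> K * h" using h by (simp add: power2_eq_square power3_eq_cube)
  also have "\<dots> \<le> (K + 1) * h" using h by simp
  also have "\<dots> \<le> (K + 1) * (\<eta> / (2 * (K + 1)))" using h K by (intro mult_left_mono) auto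
  also have "\<dots> = \<eta> / 2" using K by (simp add: field_simps)
  finally show False using \<eta> by simp
qed


lemma power_on_ray:
  assumes "0 < t" "\<bar>\<theta>\<bar> < pi"
  shows "(of_real t * cis \<theta>) powr of_real \<alpha> = of_real (t powr \<alpha>) * cis (\<alpha> * \<theta>)"
proof -
  have "Ln (of_real t * cis \<theta>) = of_real (ln t) + \<i> * of_real \<theta>"
  proof (rule Ln_unique)
    show "exp (of_real (ln t) + \<i> * of_real \<theta>) = of_real t * cis \<theta>"
      using assms by (simp add: exp_add cis_conv_exp exp_of_real)
  qed (use assms in auto)
  then have "(of_real t * cis \<theta>) powr of_real \<alpha> = exp (of_real (\<alpha> * ln t) + \<i> * of_real (\<alpha> * \<theta>))"
    using assms by (simp add: powr_def distrib_left mult_ac)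
  also have "\<dots> = of_real (t powr \<alpha>) * cis (\<alpha> * \<theta>)"
    using assms by (simp only: exp_add cis_conv_exp exp_of_real) (simp add: powr_def mult.commute)
  finally show ?thesis .
qed

text \<open>Think of \<open>\<nu> (\<lambda>k. \<rho> ^ k)\<close> as the norm of a vector-valued polynomial \<open>Q\<close> of degree \<open>d\<close> at \<open>\<rho>\<close>. It
  is at most \<open>2 * M\<close> on the convex hull of \<open>1\<close> and a disc, and of size \<open>exp (O(d)) * M\<close> at distance \<open>1\<close>.
  Were \<open>Q\<close> controlled on the real segment below \<open>1\<close> only, it could be continued past \<open>1\<close>
  by \<open>1 / d\<^sup>2\<close>; the angle at \<open>1\<close> improves this to \<open>1 / d powr \<alpha>\<close> with \<open>\<alpha> < 2\<close>.

  The map \<open>z \<mapsto> 1 + \<mu> * z powr \<alpha>\<close> opens the triangle \<open>S\<close> with vertex \<open>0\<close> and half-angle \<open>\<tau> < pi / 2\<close> to a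
  sector of half-angle \<open>\<alpha> * \<tau> = pi - \<psi>\<close> at \<open>1\<close>, whose two sides lie in the convex hull because
  \<open>tan \<psi> = r\<close>. The factor \<open>exp (- B * d * z)\<close> has modulus at most \<open>1\<close> on the two sides and compensates the growth of
  \<open>Q\<close> on the third side, where \<open>Re z = 1\<close>. The maximum principle at \<open>z = 1 / d\<close>, where this factor
  is \<open>exp (- B)\<close>, gives the bound.\<close>

lemma corner_extrapolation:
  fixes r L :: real
  assumes r: "0 < r" and L: "1 \<le> L"
  obtains \<alpha> \<mu> :: real where "1 \<le> \<alpha>" "\<alpha> < 2" "0 < \<mu>"
    "\<And>(\<nu> :: (nat \<Rightarrow> complex) \<Rightarrow> real) d M.
      (\<And>c c'. \<nu> (\<lambda>k. c k + c' k) \<le> \<nu> c + \<nu> c') \<Longrightarrow>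
      (\<And>a c. \<nu> (\<lambda>k. a * c k) = cmod a * \<nu> c) \<Longrightarrow>
      (\<And>c. \<nu> c \<le> (\<Sum>k\<le>d. cmod (c k) * L ^ k) * M) \<Longrightarrow>
      (\<And>\<sigma> q. cmod \<sigma> \<le> r \<Longrightarrow> 0 \<le> q \<Longrightarrow> q \<le> 1 \<Longrightarrow> \<nu> (\<lambda>k. (1 - of_real q * (1 - \<sigma>)) ^ k) \<le> 2 * M) \<Longrightarrow>
      0 \<le> M \<Longrightarrow> 1 \<le> d \<Longrightarrow>
      \<nu> (\<lambda>k. of_real (1 + \<mu> / real d powr \<alpha>) ^ k) \<le> 8 * L * M"
proof -
  (* The hull of 1 and the disc of radius r about 0 contains a sector of half-angle arctan r. *)
  define \<psi> where "\<psi> = arctan r"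
  have \<psi>: "0 < \<psi>" "\<psi> < pi / 2" using r arctan_ubound[of r] by (auto simp: \<psi>_def)
  have cos\<psi>: "cos \<psi> > 0" "cos \<psi> \<le> 1" using \<psi> by (auto intro: cos_gt_zero_pi)
  have sin\<psi>: "sin \<psi> = r * cos \<psi>" using cos\<psi> tan_arctan[of r] by (simp add: \<psi>_def tan_def field_simps)
  (* The critical exponent is 2 - 2 * \<psi> / pi; half of this gain leaves room for \<tau> < pi / 2. *)
  define \<alpha> where "\<alpha> = 2 - \<psi> / pi"
  have \<alpha>: "1 \<le> \<alpha>" "\<alpha> < 2" using \<psi> by (auto simp: \<alpha>_def field_simps)
  define \<tau> where "\<tau> = (pi - \<psi>) / \<alpha>"
  have \<alpha>\<tau>: "\<alpha> * \<tau> = pi - \<psi>" using \<alpha> by (simp add: \<tau>_def)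
  have "\<alpha> * (pi / 2) = pi - \<psi> / 2" by (simp add: \<alpha>_def field_simps)
  then have "\<alpha> * \<tau> < \<alpha> * (pi / 2)" using \<alpha>\<tau> \<psi> by simp
  then have "\<tau> < pi / 2" using \<alpha> by (subst (asm) mult_less_cancel_left_pos) auto
  moreover have "0 < \<tau>" using \<alpha> \<psi> by (simp add: \<tau>_def)
  ultimately have \<tau>: "0 < \<tau>" "\<tau> < pi / 2" by auto
  have cos\<tau>: "cos \<tau> > 0" "cos \<tau> \<le> 1" using \<tau> by (auto intro: cos_gt_zero_pi)
  define m where "m = tan \<tau>"
  have m: "m > 0" using \<tau> tan_gt_zero by (simp add: m_def)
  have m2: "1 + m ^ 2 = 1 / (cos \<tau>) ^ 2"
    using cos\<tau> tan_sec[of \<tau>] by (simp add: m_def power_inverse divide_inverse)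
  (* The scale keeps the image of S within distance 1 of the point 1. *)
  define \<mu> where "\<mu> = (cos \<tau>) ^ 2"
  have \<mu>: "0 < \<mu>" using cos\<tau> by (simp add: \<mu>_def)
  define B where "B = ln (4 * L)"
  have B: "B > 0" "exp B = 4 * L" using L by (auto simp: B_def)
  define S where "S = {z. \<bar>Im z\<bar> \<le> m * Re z \<and> Re z \<le> 1}"
  define U where "U = {z. \<bar>Im z\<bar> < m * Re z \<and> Re z < 1}"
  have small: "\<mu> * x powr \<alpha> \<le> 1" if "0 \<le> x" "x \<le> 1 / cos \<tau>" for x
  proof -
    have "x powr \<alpha> \<le> (1 / cos \<tau>) powr \<alpha>" using that \<alpha> by (intro powr_mono2) auto
    also have "\<dots> \<le> (1 / cos \<tau>) powr 2" using \<alpha> cos\<tau> by (intro powr_mono) auto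
    also have "\<dots> = 1 / (cos \<tau>) ^ 2" using cos\<tau> by (simp add: powr_numeral power_divide)
    finally have "\<mu> * x powr \<alpha> \<le> \<mu> * (1 / (cos \<tau>) ^ 2)" using \<mu> by (intro mult_left_mono) auto
    then show ?thesis using cos\<tau> by (simp add: \<mu>_def)
  qed
  have S_Re: "0 \<le> Re z" if "z \<in> S" for z
  proof -
    have "0 \<le> m * Re z" using that abs_ge_zero[of "Im z"] unfolding S_def mem_Collect_eq by linarith
    then show ?thesis using m by (simp add: zero_le_mult_iff)
  qed
  have S_norm: "cmod z \<le> 1 / cos \<tau>" if "z \<in> S" for z
  proof -
    have "\<bar>Im z\<bar> ^ 2 \<le> (m * Re z)\<^sup>2" using that by (intro power_mono) (auto simp: S_def)
    then have "(cmod z)\<^sup>2 \<le> (1 + m ^ 2) * (Re z)\<^sup>2" by (simp add: cmod_power2 power_mult_distrib algebra_simps)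
    also have "\<dots> \<le> (1 + m ^ 2) * 1" using S_Re[OF that] that by (intro mult_left_mono) (auto simp: S_def power_le_one)
    also have "\<dots> = (1 / cos \<tau>) ^ 2" by (simp add: m2 power_divide)
    finally show ?thesis using cos\<tau> by (auto intro: power2_le_imp_le)
  qed
  have "closed S"
    unfolding S_def by (intro closed_Collect_conj closed_Collect_le continuous_intros)
  moreover have "bounded S" using S_norm bounded_iff by blast
  ultimately have cS: "compact S" by (simp add: compact_eq_bounded_closed)
  have oU: "open U" unfolding U_def by (intro open_Collect_conj open_Collect_less continuous_intros)
  have US: "U \<subseteq> S" by (auto simp: U_def S_def)
  show ?thesis
  proof (rule that[OF \<alpha> \<mu>])
    fix \<nu> :: "(nat \<Rightarrow> complex) \<Rightarrow> real" and d :: nat and M :: real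
    assume tri: "\<And>c c'. \<nu> (\<lambda>k. c k + c' k) \<le> \<nu> c + \<nu> c'"
      and scale: "\<And>a c. \<nu> (\<lambda>k. a * c k) = cmod a * \<nu> c"
      and bound: "\<And>c. \<nu> c \<le> (\<Sum>k\<le>d. cmod (c k) * L ^ k) * M"
      and cone: "\<And>\<sigma> q. cmod \<sigma> \<le> r \<Longrightarrow> 0 \<le> q \<Longrightarrow> q \<le> 1 \<Longrightarrow> \<nu> (\<lambda>k. (1 - of_real q * (1 - \<sigma>)) ^ k) \<le> 2 * M"
      and M: "0 \<le> M" and d: "1 \<le> d"
    define \<phi> :: "complex \<Rightarrow> nat \<Rightarrow> complex"
      where "\<phi> = (\<lambda>z k. exp (- of_real (B * d) * z) * (1 + of_real \<mu> * z powr of_real \<alpha>) ^ k)"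
    have \<nu>\<phi>: "\<nu> (\<phi> z) = exp (- B * d * Re z) * \<nu> (\<lambda>k. (1 + of_real \<mu> * z powr of_real \<alpha>) ^ k)" for z
      unfolding \<phi>_def by (subst scale) (simp add: norm_exp_eq_Re)
    have \<nu>0: "0 \<le> \<nu> c" for c
    proof -
      have "\<nu> (\<lambda>k. 0) = 0" using scale[of 0 c] by simp
      moreover have "\<nu> (\<lambda>k. (-1) * c k) = \<nu> c" by (subst scale) simp
      ultimately show ?thesis using tri[of c "\<lambda>k. (-1) * c k"] by simp
    qed
    have key: "\<nu> (\<phi> z) \<le> 2 * M" if "z \<in> S" for z
    proof (rule seminorm_maximum_principle[where I = "{..d}" and S = S and U = U and L = "L ^ d * M"])
      show "\<nu> c \<le> L ^ d * M * (\<Sum>k\<le>d. cmod (c k))" for c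
      proof -
        have "(\<Sum>k\<le>d. cmod (c k) * L ^ k) \<le> (\<Sum>k\<le>d. cmod (c k) * L ^ d)"
          using L by (intro sum_mono mult_left_mono power_increasing) auto
        then have "(\<Sum>k\<le>d. cmod (c k) * L ^ k) * M \<le> (\<Sum>k\<le>d. cmod (c k) * L ^ d) * M"
          using M by (rule mult_right_mono)
        with bound[of c] show ?thesis by (simp add: sum_distrib_left sum_distrib_right mult_ac)
      qed
      show "(\<lambda>z. \<phi> z k) holomorphic_on U" for k
      proof -
        have "z \<notin> \<real>\<^sub>\<le>\<^sub>0" if "z \<in> U" for z
        proof -
          have "0 < m * Re z" using that abs_ge_zero[of "Im z"] unfolding U_def mem_Collect_eq by linarith
          then show ?thesis using m by (simp add: zero_less_mult_iff complex_nonpos_Reals_iff)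
        qed
        then show ?thesis unfolding \<phi>_def by (intro holomorphic_intros) auto
      qed
      show "continuous_on S (\<lambda>z. \<phi> z k)" for k
        unfolding \<phi>_def using S_Re \<alpha> by (intro continuous_intros) auto
      show "\<nu> (\<phi> z) \<le> 2 * M" if z: "z \<in> S - U" for z
      proof -
        have zS: "z \<in> S" using z by blast
        consider "Re z = 1" | "\<bar>Im z\<bar> = m * Re z" using z by (force simp: S_def U_def)
        then show ?thesis
        proof cases
          case 1
          let ?w = "1 + of_real \<mu> * z powr of_real \<alpha>"
          have "cmod (of_real \<mu> * z powr of_real \<alpha>) = \<mu> * cmod z powr \<alpha>"
            using \<mu> by (simp add: norm_mult norm_powr_real_powr')
          also have "\<dots> \<le> 1" using S_norm[OF zS] by (intro small) auto
          finally have w: "cmod ?w \<le> 2" using norm_triangle_ineq[of 1 "of_real \<mu> * z powr of_real \<alpha>"] by simp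
          have "(\<Sum>k\<le>d. cmod (?w ^ k) * L ^ k) \<le> (\<Sum>k\<le>d. (2 * L) ^ d)"
          proof (rule sum_mono)
            fix k assume k: "k \<in> {..d}"
            have "cmod (?w ^ k) * L ^ k = (cmod ?w * L) ^ k" by (simp add: norm_power power_mult_distrib)
            also have "\<dots> \<le> (2 * L) ^ k" using w L by (intro power_mono mult_right_mono) auto
            also have "\<dots> \<le> (2 * L) ^ d" using L k by (intro power_increasing) auto
            finally show "cmod (?w ^ k) * L ^ k \<le> (2 * L) ^ d" .
          qed
          also have "\<dots> = real (Suc d) * (2 * L) ^ d" by simp
          also have "\<dots> \<le> 2 ^ d * (2 * L) ^ d"
          proof (rule mult_right_mono)
            have "Suc d \<le> 2 ^ d" by (simp add: Suc_leI)
            then show "real (Suc d) \<le> 2 ^ d" by (metis of_nat_le_iff of_nat_numeral of_nat_power)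
          qed (use L in auto)
          also have "\<dots> = exp B ^ d" unfolding B(2) power_mult_distrib[symmetric] by simp
          also have "\<dots> = exp (B * d)" by (rule exp_of_nat2_mult[symmetric])
          finally have "\<nu> (\<lambda>k. ?w ^ k) \<le> exp (B * d) * M"
            by (intro order_trans[OF bound[of "\<lambda>k. ?w ^ k"]] mult_right_mono M)
          then have "\<nu> (\<phi> z) \<le> exp (- B * d) * (exp (B * d) * M)"
            unfolding \<nu>\<phi> 1 by simp
          also have "\<dots> = M" by (simp add: exp_minus)
          finally show ?thesis using M by simp
        next
          case 2
          define s :: real where "s = (if Im z \<ge> 0 then 1 else -1)"
          define x where "x = Re z / cos \<tau>"
          have x: "0 \<le> x" "x \<le> 1 / cos \<tau>"
            using S_Re[OF zS] zS cos\<tau> by (auto simp: x_def S_def divide_right_mono)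
          have s: "cos (s * \<theta>) = cos \<theta>" "sin (s * \<theta>) = s * sin \<theta>" for \<theta> by (auto simp: s_def)
          have zx: "z = of_real x * cis (s * \<tau>)"
          proof -
            have "Im z = s * (m * Re z)" using 2 by (auto simp: s_def)
            then show ?thesis using cos\<tau> by (simp add: complex_eq_iff x_def s m_def tan_def)
          qed
          define q where "q = \<mu> * x powr \<alpha> * cos \<psi>"
          have q: "0 \<le> q" "q \<le> 1"
            using small[OF x] \<mu> cos\<psi> by (auto simp: q_def intro: mult_le_one)
          have pw: "z powr of_real \<alpha> = of_real (x powr \<alpha>) * cis (s * (pi - \<psi>))"
          proof (cases "x = 0")
            case True
            then show ?thesis using zx by simp
          next
            case False
            then have "z powr of_real \<alpha> = of_real (x powr \<alpha>) * cis (\<alpha> * (s * \<tau>))"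
              unfolding zx using x \<tau> by (intro power_on_ray) (auto simp: s_def)
            also have "\<alpha> * (s * \<tau>) = s * (pi - \<psi>)" by (simp add: \<alpha>\<tau>[symmetric] mult.left_commute)
            finally show ?thesis .
          qed
          have "cis (s * (pi - \<psi>)) = - of_real (cos \<psi>) * (1 - \<i> * of_real (s * r))"
            by (simp add: complex_eq_iff s sin\<psi>)
          then have "1 + of_real \<mu> * z powr of_real \<alpha> = 1 - of_real q * (1 - \<i> * of_real (s * r))"
            unfolding pw by (simp add: q_def)
          moreover have "cmod (\<i> * of_real (s * r)) \<le> r" using r by (simp add: norm_mult s_def)
          ultimately have "\<nu> (\<lambda>k. (1 + of_real \<mu> * z powr of_real \<alpha>) ^ k) \<le> 2 * M"
            using cone[OF _ q, of "\<i> * of_real (s * r)"] by simp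
          moreover have "exp (- B * d * Re z) \<le> 1" using B S_Re[OF zS] by simp
          ultimately have "exp (- B * d * Re z) * \<nu> (\<lambda>k. (1 + of_real \<mu> * z powr of_real \<alpha>) ^ k) \<le> 1 * (2 * M)"
            using \<nu>0 by (intro mult_mono) auto
          then show ?thesis unfolding \<nu>\<phi> by simp
        qed
      qed
    qed (use tri scale cS oU US that L M in auto)
    define x where "x = complex_of_real (1 / real d)"
    have xS: "x \<in> S" using d m by (auto simp: x_def S_def)
    have "x powr of_real \<alpha> = of_real ((1 / real d) powr \<alpha>)"
      unfolding x_def by (rule powr_of_real) auto
    also have "(1 / real d) powr \<alpha> = 1 / real d powr \<alpha>" by (simp add: powr_divide)
    finally have "\<nu> (\<phi> x) = exp (- B) * \<nu> (\<lambda>k. of_real (1 + \<mu> / real d powr \<alpha>) ^ k)"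
      unfolding \<nu>\<phi> using d by (simp add: x_def)
    then have "exp (- B) * \<nu> (\<lambda>k. of_real (1 + \<mu> / real d powr \<alpha>) ^ k) \<le> 2 * M"
      using key[OF xS] by simp
    moreover have e: "exp B * (exp (- B) * y) = y" for y :: real
      by (simp add: exp_minus)
    ultimately have "exp B * (exp (- B) * \<nu> (\<lambda>k. of_real (1 + \<mu> / real d powr \<alpha>) ^ k)) \<le> exp B * (2 * M)"
      by (intro mult_left_mono) auto
    then show "\<nu> (\<lambda>k. of_real (1 + \<mu> / real d powr \<alpha>) ^ k) \<le> 8 * L * M"
      unfolding e unfolding B(2) by simp
  qed
qed

section \<open>From the extrapolation to the random gradient\<close>

lemma multiplier_add:
  "multiplier n (\<lambda>A. m A + m' A) f \<epsilon> = multiplier n m f \<epsilon> + multiplier n m' f \<epsilon>"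
  by (simp add: multiplier_def scaleC_add_left scaleR_add_right sum.distrib)

lemma multiplier_scale:
  "multiplier n (\<lambda>A. a * m A) f \<epsilon> = a *\<^sub>C multiplier n m f \<epsilon>"
  by (simp add: multiplier_def scaleC_sum_right scaleR_scaleC_commute scaleC_scaleC)

text \<open>The norm of \<open>\<Sum>\<^sub>A \<rho> ^ card A * fourier_coeff n f A * w\<^sub>A\<close> is a polynomial expression in \<open>\<rho>\<close> of the kind just
  treated: the cone supplies the bound near \<open>1\<close>, and the level projections bound the coefficients.\<close>

lemma inverse_noise_bound:
  fixes T :: "'a::complex_normed_vector itself"
  assumes p: "p \<ge> 1" and K: "K \<ge> 1"
  obtains \<alpha> \<mu> :: real where "1 \<le> \<alpha>" "\<alpha> < 2" "0 < \<mu>"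
    "\<And>n d (f :: (nat \<Rightarrow> real) \<Rightarrow> 'a). multiplier_bound T n p (level 1) K \<Longrightarrow> 1 \<le> d \<Longrightarrow> degree_at_most n d f \<Longrightarrow>
      avg_norm p (hcube n) (multiplier n (\<lambda>A. of_real (1 + \<mu> / real d powr \<alpha>) ^ card A) f)
        \<le> 8 * (exp 1 * K) * avg_norm p (hcube n) f"
proof -
  define L where "L = exp 1 * K"
  have "1 * 1 \<le> exp (1::real) * K" using K by (intro mult_mono) auto
  then have L: "1 \<le> L" by (simp add: L_def)
  then have r: "0 < 1 / (2 * L)" by simp
  obtain \<alpha> \<mu> :: real where am: "1 \<le> \<alpha>" "\<alpha> < 2" "0 < \<mu>"
    and extra: "\<And>(\<nu> :: (nat \<Rightarrow> complex) \<Rightarrow> real) d M.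
      (\<And>c c'. \<nu> (\<lambda>k. c k + c' k) \<le> \<nu> c + \<nu> c') \<Longrightarrow>
      (\<And>a c. \<nu> (\<lambda>k. a * c k) = cmod a * \<nu> c) \<Longrightarrow>
      (\<And>c. \<nu> c \<le> (\<Sum>k\<le>d. cmod (c k) * L ^ k) * M) \<Longrightarrow>
      (\<And>\<sigma> q. cmod \<sigma> \<le> 1 / (2 * L) \<Longrightarrow> 0 \<le> q \<Longrightarrow> q \<le> 1 \<Longrightarrow> \<nu> (\<lambda>k. (1 - of_real q * (1 - \<sigma>)) ^ k) \<le> 2 * M) \<Longrightarrow>
      0 \<le> M \<Longrightarrow> 1 \<le> d \<Longrightarrow>
      \<nu> (\<lambda>k. of_real (1 + \<mu> / real d powr \<alpha>) ^ k) \<le> 8 * L * M"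
    using corner_extrapolation[OF r L] by blast
  show ?thesis
  proof (rule that[OF am])
    fix n d and f :: "(nat \<Rightarrow> real) \<Rightarrow> 'a"
    assume b: "multiplier_bound T n p (level 1) K" and d: "1 \<le> d" and deg: "degree_at_most n d f"
    let ?H = "hcube n"
    define \<nu> where "\<nu> = (\<lambda>c :: nat \<Rightarrow> complex. avg_norm p ?H (multiplier n (\<lambda>A. c (card A)) f))"
    have "\<nu> (\<lambda>k. of_real (1 + \<mu> / real d powr \<alpha>) ^ k) \<le> 8 * L * avg_norm p ?H f"
    proof (rule extra[OF _ _ _ _ _ d])
      show "\<nu> (\<lambda>k. c k + c' k) \<le> \<nu> c + \<nu> c'" for c c'
        unfolding \<nu>_def multiplier_add[abs_def] using p by (intro avg_norm_triangle) auto
      show "\<nu> (\<lambda>k. a * c k) = cmod a * \<nu> c" for a c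
        unfolding \<nu>_def multiplier_scale[abs_def] using p by (intro avg_norm_scale) (auto simp: norm_scaleC)
      show "\<nu> c \<le> (\<Sum>k\<le>d. cmod (c k) * L ^ k) * avg_norm p ?H f" for c
      proof -
        have "multiplier n (\<lambda>A. c (card A)) f = multiplier n (\<lambda>A. \<Sum>k\<le>d. c k * level k A) f"
        proof (rule multiplier_cong)
          fix A assume A: "A \<subseteq> {1..n}"
          show "fourier_coeff n f A = 0 \<or> c (card A) = (\<Sum>k\<le>d. c k * level k A)"
          proof (cases "card A \<le> d")
            case True
            then show ?thesis by (simp add: level_def if_distrib cong: if_cong)
          next
            case False
            then show ?thesis using deg A by (simp add: degree_at_most_def)
          qed
        qed
        moreover have "multiplier_bound T n p (\<lambda>A. \<Sum>k\<le>d. c k * level k A) (\<Sum>k\<le>d. cmod (c k) * L ^ k)"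
          unfolding L_def using b K p by (intro multiplier_bound_sum multiplier_bound_level) auto
        ultimately show ?thesis by (simp add: \<nu>_def multiplier_bound_def)
      qed
      show "\<nu> (\<lambda>k. (1 - of_real q * (1 - \<sigma>)) ^ k) \<le> 2 * avg_norm p ?H f"
        if "cmod \<sigma> \<le> 1 / (2 * L)" "0 \<le> q" "q \<le> 1" for \<sigma> q
      proof -
        have "cmod \<sigma> * (exp 1 * K) \<le> 1 / 2"
          using mult_right_mono[OF that(1), of L] L K by (simp add: L_def)
        then have "multiplier_bound T n p (\<lambda>A. (1 - of_real q * (1 - \<sigma>)) ^ card A) 2"
          using p b K that by (intro multiplier_bound_cone) auto
        then show ?thesis by (simp add: \<nu>_def multiplier_bound_def)
      qed
    qed (simp add: avg_norm_nonneg)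
    then show "avg_norm p ?H (multiplier n (\<lambda>A. of_real (1 + \<mu> / real d powr \<alpha>) ^ card A) f)
        \<le> 8 * (exp 1 * K) * avg_norm p ?H f"
      by (simp add: \<nu>_def L_def)
  qed
qed

lemma partial_deriv_walsh:
  fixes f :: "(nat \<Rightarrow> real) \<Rightarrow> 'a::real_normed_vector"
  assumes \<epsilon>: "\<epsilon> \<in> hcube n" and i: "i \<in> {1..n}"
  shows "partial_deriv i f \<epsilon> = (\<Sum>A\<in>Pow {1..n}. if i \<in> A then walsh A \<epsilon> *\<^sub>R fourier_coeff n f A else 0)"
proof -
  let ?\<epsilon>' = "\<epsilon>(i := - \<epsilon> i)"
  have pm: "\<epsilon> k \<in> {-1, 1}" if "k \<in> {1..n}" for k
    using \<epsilon> that unfolding hcube_def by (rule PiE_mem)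
  have \<epsilon>': "?\<epsilon>' \<in> hcube n"
    unfolding hcube_def
  proof (rule PiE_I)
    fix k assume "k \<in> {1..n}"
    then show "?\<epsilon>' k \<in> {-1, 1}" using pm[of k] by auto
  next
    fix k assume k: "k \<notin> {1..n}"
    then show "?\<epsilon>' k = undefined" using i PiE_arb[OF \<epsilon>[unfolded hcube_def] k] by auto
  qed
  have w: "walsh A ?\<epsilon>' = (if i \<in> A then - walsh A \<epsilon> else walsh A \<epsilon>)" if "A \<in> Pow {1..n}" for A
  proof -
    have fA: "finite A" using that finite_subset by blast
    have rest: "(\<Prod>k\<in>A - {i}. ?\<epsilon>' k) = (\<Prod>k\<in>A - {i}. \<epsilon> k)" by (intro prod.cong) auto
    show ?thesis
    proof (cases "i \<in> A")
      case True
      then show ?thesis using rest fA by (simp add: walsh_def prod.remove[of A i])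
    next
      case False
      then show ?thesis using rest by (simp add: walsh_def)
    qed
  qed
  have "partial_deriv i f \<epsilon> = (1 / 2) *\<^sub>R (\<Sum>A\<in>Pow {1..n}. (walsh A \<epsilon> - walsh A ?\<epsilon>') *\<^sub>R fourier_coeff n f A)"
    unfolding partial_deriv_def
    by (simp only: fourier_inversion[OF \<epsilon>, of f] fourier_inversion[OF \<epsilon>', of f] sum_subtractf scaleR_left_diff_distrib)
  also have "\<dots> = (\<Sum>A\<in>Pow {1..n}. if i \<in> A then walsh A \<epsilon> *\<^sub>R fourier_coeff n f A else 0)"
    unfolding scaleR_sum_right by (intro sum.cong refl) (auto simp: w simp del: One_nat_def)
  finally show ?thesis .
qed

text \<open>The random gradient of \<open>f\<close> is, up to a factor, the Rademacher projection in \<open>\<delta>\<close> of the average of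
  \<open>g (twist n S \<delta> \<epsilon>)\<close> over random sets \<open>S\<close> of density \<open>q\<close>: at frequency \<open>A\<close> this average is
  \<open>\<Prod>i\<in>A. q * \<delta> i + (1 - q)\<close>, with linear part \<open>q * (1 - q) ^ (card A - 1) * (\<Sum>i\<in>A. \<delta> i)\<close>. Since
  \<open>1 - q = 1 / (1 + s)\<close>, the passage from \<open>f\<close> to \<open>g\<close> cancels the powers of \<open>1 - q\<close>.\<close>

lemma random_gradient_as_average:
  fixes f :: "(nat \<Rightarrow> real) \<Rightarrow> 'a::complex_normed_vector"
  assumes s: "s > 0" and \<epsilon>: "\<epsilon> \<in> hcube n"
    and g: "g = multiplier n (\<lambda>A. of_real (1 + s) ^ card A) f" and q: "q = s / (1 + s)"
  shows "(\<Sum>i=1..n. \<delta> i *\<^sub>R partial_deriv i f \<epsilon>)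
    = (1 / s) *\<^sub>R (\<Sum>S\<in>Pow {1..n}. subset_weight {1..n} q S *\<^sub>R multiplier n (\<lambda>A. level 1 (A \<inter> S)) g (twist n S \<delta> \<epsilon>))"
proof -
  let ?P = "Pow {1..n}"
  have coeff: "(\<Sum>S\<in>?P. of_real (subset_weight {1..n} q S) * (of_real (walsh (A \<inter> S) \<delta>) * level 1 (A \<inter> S))) * of_real (1 + s) ^ card A
      = of_real (s * (\<Sum>i\<in>A. \<delta> i))" if A: "A \<in> ?P" for A
  proof -
    have fA: "finite A" using A finite_subset by blast
    have "(\<Sum>S\<in>?P. of_real (subset_weight {1..n} q S) * (of_real (walsh (A \<inter> S) \<delta>) * level 1 (A \<inter> S)))
        = (\<Sum>U\<in>Pow A. of_real (subset_weight A q U) * (of_real (walsh U \<delta>) * level 1 U))"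
      using A by (intro subset_weight_inter) auto
    also have "\<dots> = (\<Sum>U\<in>(\<lambda>i. {i}) ` A. of_real (subset_weight A q U) * (of_real (walsh U \<delta>) * level 1 U))"
      using fA by (intro sum.mono_neutral_right) (auto simp: level_def card_1_singleton_iff)
    also have "\<dots> = of_real (\<Sum>i\<in>A. q * (1 - q) ^ (card A - 1) * \<delta> i)"
      using fA by (subst sum.reindex) (auto simp: level_def subset_weight_def walsh_def)
    finally have "(\<Sum>S\<in>?P. of_real (subset_weight {1..n} q S) * (of_real (walsh (A \<inter> S) \<delta>) * level 1 (A \<inter> S))) * of_real (1 + s) ^ card A
        = complex_of_real ((\<Sum>i\<in>A. q * (1 - q) ^ (card A - 1) * \<delta> i) * (1 + s) ^ card A)"
      by simp
    also have "(\<Sum>i\<in>A. q * (1 - q) ^ (card A - 1) * \<delta> i) * (1 + s) ^ card A = (\<Sum>i\<in>A. s * \<delta> i)"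
      unfolding sum_distrib_right
    proof (rule sum.cong[OF refl])
      fix i assume "i \<in> A"
      then have "card A > 0" using fA card_gt_0_iff by blast
      then obtain k where k: "card A = Suc k" using gr0_conv_Suc by blast
      have "1 - q = 1 / (1 + s)" "q * (1 + s) = s" using s by (auto simp: q field_simps)
      then have one: "(1 - q) * (1 + s) = 1" "q * (1 + s) = s" using s by simp_all
      have "q * (1 - q) ^ k * (1 + s) ^ Suc k = (q * (1 + s)) * ((1 - q) * (1 + s)) ^ k"
        unfolding power_mult_distrib by simp
      also have "\<dots> = s" unfolding one by simp
      finally show "q * (1 - q) ^ (card A - 1) * \<delta> i * (1 + s) ^ card A = s * \<delta> i"
        by (simp add: k mult_ac)
    qed
    finally show ?thesis by (simp only: sum_distrib_left)
  qed
  have "(\<Sum>S\<in>?P. subset_weight {1..n} q S *\<^sub>R multiplier n (\<lambda>A. level 1 (A \<inter> S)) g (twist n S \<delta> \<epsilon>))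
      = (\<Sum>S\<in>?P. \<Sum>A\<in>?P. walsh A \<epsilon> *\<^sub>R ((of_real (subset_weight {1..n} q S) * (of_real (walsh (A \<inter> S) \<delta>) * level 1 (A \<inter> S)) * of_real (1 + s) ^ card A) *\<^sub>C fourier_coeff n f A))"
    unfolding multiplier_def[of n "\<lambda>A. level 1 (A \<inter> _)"] scaleR_sum_right
    by (intro sum.cong refl)
      (auto simp: g fourier_coeff_multiplier walsh_twist scaleR_scaleC scaleC_scaleC mult_ac simp del: One_nat_def)
  also have "\<dots> = (\<Sum>A\<in>?P. walsh A \<epsilon> *\<^sub>R (((\<Sum>S\<in>?P. of_real (subset_weight {1..n} q S) * (of_real (walsh (A \<inter> S) \<delta>) * level 1 (A \<inter> S))) * of_real (1 + s) ^ card A) *\<^sub>C fourier_coeff n f A))"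
    unfolding sum_distrib_right scaleC_sum_left scaleR_sum_right by (rule sum.swap)
  also have "\<dots> = (\<Sum>A\<in>?P. walsh A \<epsilon> *\<^sub>R (of_real (s * (\<Sum>i\<in>A. \<delta> i)) *\<^sub>C fourier_coeff n f A))"
    by (intro sum.cong refl) (simp only: coeff)
  also have "\<dots> = s *\<^sub>R (\<Sum>A\<in>?P. \<Sum>i\<in>A. \<delta> i *\<^sub>R walsh A \<epsilon> *\<^sub>R fourier_coeff n f A)"
    unfolding scaleR_scaleC[symmetric] scaleR_sum_right
    by (intro sum.cong refl) (simp add: scaleR_sum_left[symmetric] sum_distrib_left mult_ac)
  also have "(\<Sum>A\<in>?P. \<Sum>i\<in>A. \<delta> i *\<^sub>R walsh A \<epsilon> *\<^sub>R fourier_coeff n f A)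
      = (\<Sum>A\<in>?P. \<Sum>i=1..n. if i \<in> A then \<delta> i *\<^sub>R walsh A \<epsilon> *\<^sub>R fourier_coeff n f A else 0)"
  proof (rule sum.cong[OF refl])
    fix A assume "A \<in> ?P"
    then show "(\<Sum>i\<in>A. \<delta> i *\<^sub>R walsh A \<epsilon> *\<^sub>R fourier_coeff n f A)
        = (\<Sum>i=1..n. if i \<in> A then \<delta> i *\<^sub>R walsh A \<epsilon> *\<^sub>R fourier_coeff n f A else 0)"
      by (intro sum.mono_neutral_cong_left) auto
  qed
  also have "\<dots> = (\<Sum>i=1..n. \<Sum>A\<in>?P. if i \<in> A then \<delta> i *\<^sub>R walsh A \<epsilon> *\<^sub>R fourier_coeff n f A else 0)"
    by (rule sum.swap)
  also have "\<dots> = (\<Sum>i=1..n. \<delta> i *\<^sub>R partial_deriv i f \<epsilon>)"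
    by (intro sum.cong refl) (auto simp: partial_deriv_walsh[OF \<epsilon>] scaleR_sum_right intro!: sum.cong simp del: One_nat_def)
  finally show ?thesis using s by simp
qed

text \<open>Each summand of the average is a Rademacher projection in the coordinates of \<open>S\<close>, followed by a twist that preserves
  the joint norm in \<open>(\<delta>, \<epsilon>)\<close>.\<close>

lemma random_gradient_bound:
  fixes f :: "(nat \<Rightarrow> real) \<Rightarrow> 'a::complex_normed_vector"
  assumes p: "p \<ge> 1" and K: "multiplier_bound TYPE('a) n p (level 1) K" "K \<ge> 0" and s: "s > 0"
  shows "avg_norm p (hcube n) (\<lambda>\<delta>. avg_norm p (hcube n) (\<lambda>\<epsilon>. \<Sum>i=1..n. \<delta> i *\<^sub>R partial_deriv i f \<epsilon>))
    \<le> K / s * avg_norm p (hcube n) (multiplier n (\<lambda>A. of_real (1 + s) ^ card A) f)"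
proof -
  let ?H = "hcube n" and ?P = "Pow {1..n}"
  define g where "g = multiplier n (\<lambda>A. of_real (1 + s) ^ card A) f"
  define q where "q = s / (1 + s)"
  have q: "0 \<le> q" "q \<le> 1" using s by (auto simp: q_def)
  let ?w = "subset_weight {1..n} q"
  let ?G = "\<lambda>S. multiplier n (\<lambda>A. level 1 (A \<inter> S)) g"
  have p0: "p > 0" using p by simp
  have "avg_norm p ?H (\<lambda>\<delta>. avg_norm p ?H (\<lambda>\<epsilon>. \<Sum>i=1..n. \<delta> i *\<^sub>R partial_deriv i f \<epsilon>))
      = avg_norm p (?H \<times> ?H) (\<lambda>(\<delta>, \<epsilon>). \<Sum>i=1..n. \<delta> i *\<^sub>R partial_deriv i f \<epsilon>)"
    by (rule avg_norm_Times[OF p0, symmetric])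
  also have "\<dots> = 1 / s * avg_norm p (?H \<times> ?H) (\<lambda>x. \<Sum>S\<in>?P. ?w S *\<^sub>R ?G S (twist n S (fst x) (snd x)))"
    using s by (intro avg_norm_scale[OF p0]) (auto simp: random_gradient_as_average[OF s _ g_def q_def] simp del: One_nat_def)
  finally have eq: "avg_norm p ?H (\<lambda>\<delta>. avg_norm p ?H (\<lambda>\<epsilon>. \<Sum>i=1..n. \<delta> i *\<^sub>R partial_deriv i f \<epsilon>))
      = 1 / s * avg_norm p (?H \<times> ?H) (\<lambda>x. \<Sum>S\<in>?P. ?w S *\<^sub>R ?G S (twist n S (fst x) (snd x)))" .
  have "avg_norm p (?H \<times> ?H) (\<lambda>x. \<Sum>S\<in>?P. ?w S *\<^sub>R ?G S (twist n S (fst x) (snd x)))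
      \<le> (\<Sum>S\<in>?P. avg_norm p (?H \<times> ?H) (\<lambda>x. ?w S *\<^sub>R ?G S (twist n S (fst x) (snd x))))"
    using p by (intro avg_norm_sum) auto
  also have "\<dots> = (\<Sum>S\<in>?P. ?w S * avg_norm p ?H (?G S))"
  proof (rule sum.cong[OF refl])
    fix S
    have "avg_norm p (?H \<times> ?H) (\<lambda>x. ?w S *\<^sub>R ?G S (twist n S (fst x) (snd x)))
        = ?w S * avg_norm p (?H \<times> ?H) (\<lambda>(\<delta>, \<epsilon>). ?G S (twist n S \<delta> \<epsilon>))"
    proof (rule avg_norm_scale[OF p0])
      show "0 \<le> ?w S" using q by (rule subset_weight_nonneg)
      then show "norm (?w S *\<^sub>R ?G S (twist n S (fst x) (snd x)))
          = ?w S * norm (case x of (\<delta>, \<epsilon>) \<Rightarrow> ?G S (twist n S \<delta> \<epsilon>))" for x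
        by (simp only: norm_scaleR abs_of_nonneg case_prod_beta)
    qed
    also have "avg_norm p (?H \<times> ?H) (\<lambda>(\<delta>, \<epsilon>). ?G S (twist n S \<delta> \<epsilon>))
        = avg_norm p ?H (\<lambda>\<delta>. avg_norm p ?H (\<lambda>\<epsilon>. ?G S (twist n S \<delta> \<epsilon>)))"
      by (rule avg_norm_Times[OF p0])
    also have "\<dots> = avg_norm p ?H (?G S)"
      by (rule avg_norm_twist[OF p0])
    finally show "avg_norm p (?H \<times> ?H) (\<lambda>x. ?w S *\<^sub>R ?G S (twist n S (fst x) (snd x))) = ?w S * avg_norm p ?H (?G S)" .
  qed
  also have "\<dots> \<le> (\<Sum>S\<in>?P. ?w S * (K * avg_norm p ?H g))"
  proof (rule sum_mono)
    fix S
    have "avg_norm p ?H (?G S) \<le> K * avg_norm p ?H g"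
      using multiplier_bound_restrict[OF p0 K, of S] unfolding multiplier_bound_def by (rule spec)
    then show "?w S * avg_norm p ?H (?G S) \<le> ?w S * (K * avg_norm p ?H g)"
      using q by (intro mult_left_mono subset_weight_nonneg)
  qed
  also have "\<dots> = K * avg_norm p ?H g"
    unfolding sum_distrib_right[symmetric] by (simp add: sum_subset_weight)
  finally have "1 / s * avg_norm p (?H \<times> ?H) (\<lambda>x. \<Sum>S\<in>?P. ?w S *\<^sub>R ?G S (twist n S (fst x) (snd x)))
      \<le> 1 / s * (K * avg_norm p ?H g)"
    using s by (intro mult_left_mono) auto
  then show ?thesis unfolding eq g_def by simp
qed

theorem theorem9:
  assumes "K_convex TYPE('a::complex_banach)"
  shows "\<forall>p::real. 1 < p \<longrightarrow>
    (\<exists>\<alpha> C :: real. 1 \<le> \<alpha> \<and> \<alpha> < 2 \<and> 0 < C \<and>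
      (\<forall>(n::nat) (d::nat) (f :: (nat \<Rightarrow> real) \<Rightarrow> 'a).
        1 \<le> d \<and> d \<le> n \<and> degree_at_most n d f \<longrightarrow>
        (1 / 2 ^ n * (\<Sum>\<delta>\<in>hcube n.
            Lp_norm n p (\<lambda>\<epsilon>. \<Sum>i=1..n. \<delta> i *\<^sub>R partial_deriv i f \<epsilon>) powr p)) powr (1 / p)
          \<le> C * real d powr \<alpha> * (ln (real d) + 1) * Lp_norm n p f))"
proof (intro allI impI)
  fix p :: real assume p: "1 < p"
  obtain K0 where K0: "K0 \<ge> 0" "\<And>n. n \<ge> 1 \<Longrightarrow> multiplier_bound TYPE('a) n p (level 1) K0"
    using multiplier_bound_level_1_all_exponents[OF assms p] by metis
  define K where "K = max 1 K0"
  have K: "K \<ge> 1" "\<And>n. n \<ge> 1 \<Longrightarrow> multiplier_bound TYPE('a) n p (level 1) K"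
    using multiplier_bound_mono[OF K0(2)] by (auto simp: K_def)
  obtain \<alpha> \<mu> :: real where am: "1 \<le> \<alpha>" "\<alpha> < 2" "0 < \<mu>"
    and inv: "\<And>n d (f :: (nat \<Rightarrow> real) \<Rightarrow> 'a). multiplier_bound TYPE('a) n p (level 1) K \<Longrightarrow> 1 \<le> d \<Longrightarrow> degree_at_most n d f \<Longrightarrow>
      avg_norm p (hcube n) (multiplier n (\<lambda>A. of_real (1 + \<mu> / real d powr \<alpha>) ^ card A) f)
        \<le> 8 * (exp 1 * K) * avg_norm p (hcube n) f"
    using inverse_noise_bound[of p K, where ?'a = 'a] p K(1) by (metis less_imp_le)
  define C where "C = K / \<mu> * (8 * (exp 1 * K))"
  have C: "C > 0" using K(1) am by (simp add: C_def)
  have "(1 / 2 ^ n * (\<Sum>\<delta>\<in>hcube n. Lp_norm n p (\<lambda>\<epsilon>. \<Sum>i=1..n. \<delta> i *\<^sub>R partial_deriv i f \<epsilon>) powr p)) powr (1 / p)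
      \<le> C * real d powr \<alpha> * (ln (real d) + 1) * Lp_norm n p f"
    if d: "1 \<le> d" "d \<le> n" and deg: "degree_at_most n d f" for n d and f :: "(nat \<Rightarrow> real) \<Rightarrow> 'a"
  proof -
    define s where "s = \<mu> / real d powr \<alpha>"
    have s: "s > 0" using am d by (simp add: s_def)
    have bd: "multiplier_bound TYPE('a) n p (level 1) K" using d by (intro K) auto
    have "(1 / 2 ^ n * (\<Sum>\<delta>\<in>hcube n. Lp_norm n p (\<lambda>\<epsilon>. \<Sum>i=1..n. \<delta> i *\<^sub>R partial_deriv i f \<epsilon>) powr p)) powr (1 / p)
        = avg_norm p (hcube n) (\<lambda>\<delta>. avg_norm p (hcube n) (\<lambda>\<epsilon>. \<Sum>i=1..n. \<delta> i *\<^sub>R partial_deriv i f \<epsilon>))"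
      by (simp add: Lp_norm_eq_avg_norm avg_norm_def[of p "hcube n" "\<lambda>\<delta>. avg_norm p _ (_ \<delta>)"] card_hcube avg_norm_nonneg)
    also have "\<dots> \<le> K / s * avg_norm p (hcube n) (multiplier n (\<lambda>A. of_real (1 + s) ^ card A) f)"
      using p K(1) by (intro random_gradient_bound bd s) auto
    also have "\<dots> \<le> K / s * (8 * (exp 1 * K) * avg_norm p (hcube n) f)"
    proof (rule mult_left_mono)
      show "0 \<le> K / s" using s K(1) by simp
    qed (unfold s_def, rule inv[OF bd d(1) deg])
    also have "\<dots> = C * real d powr \<alpha> * 1 * Lp_norm n p f"
      by (simp add: C_def s_def Lp_norm_eq_avg_norm)
    also have "\<dots> \<le> C * real d powr \<alpha> * (ln (real d) + 1) * Lp_norm n p f"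
      using C d by (intro mult_right_mono mult_left_mono) (auto simp: Lp_norm_eq_avg_norm avg_norm_nonneg)
    finally show ?thesis .
  qed
  with am C show "\<exists>\<alpha> C :: real. 1 \<le> \<alpha> \<and> \<alpha> < 2 \<and> 0 < C \<and>
      (\<forall>(n::nat) (d::nat) (f :: (nat \<Rightarrow> real) \<Rightarrow> 'a).
        1 \<le> d \<and> d \<le> n \<and> degree_at_most n d f \<longrightarrow>
        (1 / 2 ^ n * (\<Sum>\<delta>\<in>hcube n.
            Lp_norm n p (\<lambda>\<epsilon>. \<Sum>i=1..n. \<delta> i *\<^sub>R partial_deriv i f \<epsilon>) powr p)) powr (1 / p)
          \<le> C * real d powr \<alpha> * (ln (real d) + 1) * Lp_norm n p f)"
    by blast
qed

end
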